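(* Let $m\in(0,+\infty)$ and let $G=(V,E,\omega,\mu)$ be a graph with $\mu_{\min}>0$, $\mu_{\max}<\infty$, $\omega_{\min}>0$ and $D_\mu<\infty$, satisfying $CDE(n,0)$ for some $n\in(0,\infty)$ and such that for some constant $c_3>0$, $\mathcal V(x,R)\ge c_3R^m$ for all $x\in V$ and all $R>0$. Let $p,q\ge1$ with $pq>1$, assume $$\frac{\max\{p,q\}+1}{pq-1}<\frac m2,$$ and put $r_2=\frac m2\left(\frac{pq-1}{\max\{p,q\}+1}\right)$. Then there exists a constant $\hat C_1>0$ such that the following holds: for any bounded nonnegative $u_0,v_0$ on $V$ with $$\|u_0\|_{\ell^{r_2}(V)}+\|v_0\|_{\ell^{r_2}(V)}^{p}\le\hat C_1$$ and any $T>0$, if $(u,v)$ is a solution for $t\in[0,T]$ of the system $$u_t=\Delta u+v^p,\quad v_t=\Delta v+u^q,\quad u(0,\cdot)=u_0,\quad v(0,\cdot)=v_0,$$ then $(u,v)$ is a global solution of this system.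
   Context: Graphs: $G=(V,E,\omega,\mu)$ is an infinite, locally finite, connected graph without loops or multiple edges; $\omega:V\times V\to[0,\infty)$ is symmetric with $\omega_{xy}>0$ iff $x\sim y$ (i.e. $xy\in E$); $\mu:V\to(0,\infty)$. Notation: $\mu_{\min}=\inf_V\mu$, $\mu_{\max}=\sup_V\mu$, $\omega_{\min}=\inf_{xy\in E}\omega_{xy}$, $D_\mu=\sup_{x\in V}\frac{1}{\mu(x)}\sum_{y\sim x}\omega_{xy}$. $d(x,y)$ is the combinatorial graph distance, $B(x,R)=\{y\in V:d(x,y)\le R\}$, and $\mathcal V(x,R)=\sum_{y\in B(x,R)}\mu(y)$. $\ell^r(V)=\ell^r(V,\mu)$ has norm $\|f\|_{\ell^r(V)}=(\sum_{x}\mu(x)|f(x)|^r)^{1/r}$ for $1\le r<\infty$ and $\|f\|_{\ell^\infty(V)}=\sup_V|f|$. $C([0,T];X)$ is the space of norm-continuous maps from $[0,T]$ to the Banach space $X$. Laplacian: $\Delta f(x)=\frac1{\mu(x)}\sum_{y\sim x}\omega_{xy}(f(y)-f(x))$. Gradient forms: $\Gamma(f,g)(x)=\frac1{2\mu(x)}\sum_{y\sim x}\omega_{xy}(f(y)-f(x))(g(y)-g(x))$, $\Gamma_2(f,g)=\frac12(\Delta\Gamma(f,g)-\Gamma(f,\Delta g)-\Gamma(\Delta f,g))$, $\Gamma(f)=\Gamma(f,f)$, $\Gamma_2(f)=\Gamma_2(f,f)$. $CDE(n,K)$ ($n>0$, $K\in\mathbb R$): for every $x\in V$ and every $f:V\to(0,\infty)$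 with $\Delta f(x)<0$, $\Gamma_2(f)(x)-\Gamma\left(f,\frac{\Gamma(f)}{f}\right)(x)\ge\frac1n(\Delta f(x))^2+K\Gamma(f)(x)$. A pair $(u,v)$ of nonnegative functions on $[0,T]\times V$ is a solution of the system in $[0,T]$ if $u,v\in C([0,T];\ell^\infty(V))$, the two equations hold for every $t\in[0,T]$ and $x\in V$ (one-sided time derivatives at the endpoints), and the initial conditions hold. "$(u,v)$ is a global solution" means that $(u,v)$ extends to a pair of functions on $[0,\infty)\times V$ which is a solution in $[0,T']$ for every $T'>0$. *)

theory Defs
  imports "HOL-Analysis.Analysis"
begin

text \<open>
  The vertex set is the whole type \<open>'v\<close>. The edge relation \<open>E\<close> is a set of ordered pairs, so
  multiple edges cannot occur; its symmetry follows from that of \<open>\<omega>\<close>.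
\<close>

locale weighted_graph =
  fixes E :: "('v \<times> 'v) set"
    and \<omega> :: "'v \<Rightarrow> 'v \<Rightarrow> real"
    and \<mu> :: "'v \<Rightarrow> real"
  assumes infinite_verts: "infinite (UNIV :: 'v set)"
    and locally_finite: "finite {y. (x, y) \<in> E}"
    and connected_verts: "(x, y) \<in> E\<^sup>*"
    and no_loops: "(x, x) \<notin> E"
    and weight_nonneg: "0 \<le> \<omega> x y"
    and weight_sym: "\<omega> x y = \<omega> y x"
    and weight_pos_iff: "0 < \<omega> x y \<longleftrightarrow> (x, y) \<in> E"
    and measure_pos: "0 < \<mu> x"

text \<open>Extended-real infima and suprema, so that finiteness is expressed literally by \<open>< \<infinity>\<close>.\<close>

definition mu_min :: "('v \<Rightarrow> real) \<Rightarrow> ereal"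
  where "mu_min \<mu> = (INF x. ereal (\<mu> x))"

definition mu_max :: "('v \<Rightarrow> real) \<Rightarrow> ereal"
  where "mu_max \<mu> = (SUP x. ereal (\<mu> x))"

definition omega_min :: "('v \<times> 'v) set \<Rightarrow> ('v \<Rightarrow> 'v \<Rightarrow> real) \<Rightarrow> ereal"
  where "omega_min E \<omega> = (INF (x, y)\<in>E. ereal (\<omega> x y))"

definition D_mu :: "('v \<times> 'v) set \<Rightarrow> ('v \<Rightarrow> 'v \<Rightarrow> real) \<Rightarrow> ('v \<Rightarrow> real) \<Rightarrow> ereal"
  where "D_mu E \<omega> \<mu> = (SUP x. ereal (1 / \<mu> x * (\<Sum>y | (x, y) \<in> E. \<omega> x y)))"

text \<open>Least length of a walk; only meaningful for connected vertices.\<close>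

definition gdist :: "('v \<times> 'v) set \<Rightarrow> 'v \<Rightarrow> 'v \<Rightarrow> nat"
  where "gdist E x y = (LEAST k. (x, y) \<in> E ^^ k)"

definition gball :: "('v \<times> 'v) set \<Rightarrow> 'v \<Rightarrow> real \<Rightarrow> 'v set"
  where "gball E x R = {y. real (gdist E x y) \<le> R}"

definition volume :: "('v \<times> 'v) set \<Rightarrow> ('v \<Rightarrow> real) \<Rightarrow> 'v \<Rightarrow> real \<Rightarrow> real"
  where "volume E \<mu> x R = (\<Sum>y\<in>gball E x R. \<mu> y)"

text \<open>
  Membership in \<open>\<ell>\<^sup>r(V, \<mu>)\<close> and its norm for \<open>1 \<le> r < \<infinity>\<close>. The norm is real-valued and
  only meaningful together with membership (\<open>infsum\<close> of a non-summable family is \<open>0\<close>).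
\<close>

definition in_ell :: "('v \<Rightarrow> real) \<Rightarrow> real \<Rightarrow> ('v \<Rightarrow> real) \<Rightarrow> bool"
  where "in_ell \<mu> r f \<longleftrightarrow> (\<lambda>x. \<mu> x * \<bar>f x\<bar> powr r) summable_on UNIV"

definition ell_norm :: "('v \<Rightarrow> real) \<Rightarrow> real \<Rightarrow> ('v \<Rightarrow> real) \<Rightarrow> real"
  where "ell_norm \<mu> r f = (\<Sum>\<^sub>\<infinity>x. \<mu> x * \<bar>f x\<bar> powr r) powr (1 / r)"

definition in_ell_infty :: "('v \<Rightarrow> real) \<Rightarrow> bool"
  where "in_ell_infty f \<longleftrightarrow> bounded (range f)"

definition ell_infty_norm :: "('v \<Rightarrow> real) \<Rightarrow> real"
  where "ell_infty_norm f = (SUP x. \<bar>f x\<bar>)"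

text \<open>The space \<open>C([0,T]; \<ell>\<^sup>\<infinity>(V))\<close>.\<close>

definition cont_ell_infty :: "real \<Rightarrow> (real \<Rightarrow> 'v \<Rightarrow> real) \<Rightarrow> bool"
  where "cont_ell_infty T u \<longleftrightarrow>
    (\<forall>t\<in>{0..T}. in_ell_infty (u t)) \<and>
    (\<forall>t\<in>{0..T}. ((\<lambda>s. ell_infty_norm (\<lambda>x. u s x - u t x)) \<longlongrightarrow> 0) (at t within {0..T}))"

definition laplacian ::
    "('v \<times> 'v) set \<Rightarrow> ('v \<Rightarrow> 'v \<Rightarrow> real) \<Rightarrow> ('v \<Rightarrow> real) \<Rightarrow> ('v \<Rightarrow> real) \<Rightarrow> 'v \<Rightarrow> real"
  where "laplacian E \<omega> \<mu> f x = 1 / \<mu> x * (\<Sum>y | (x, y) \<in> E. \<omega> x y * (f y - f x))"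

definition Gam ::
    "('v \<times> 'v) set \<Rightarrow> ('v \<Rightarrow> 'v \<Rightarrow> real) \<Rightarrow> ('v \<Rightarrow> real)
      \<Rightarrow> ('v \<Rightarrow> real) \<Rightarrow> ('v \<Rightarrow> real) \<Rightarrow> 'v \<Rightarrow> real"
  where "Gam E \<omega> \<mu> f g x =
    1 / (2 * \<mu> x) * (\<Sum>y | (x, y) \<in> E. \<omega> x y * (f y - f x) * (g y - g x))"

definition Gam2 ::
    "('v \<times> 'v) set \<Rightarrow> ('v \<Rightarrow> 'v \<Rightarrow> real) \<Rightarrow> ('v \<Rightarrow> real)
      \<Rightarrow> ('v \<Rightarrow> real) \<Rightarrow> ('v \<Rightarrow> real) \<Rightarrow> 'v \<Rightarrow> real"
  where "Gam2 E \<omega> \<mu> f g x =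
    1 / 2 * (laplacian E \<omega> \<mu> (Gam E \<omega> \<mu> f g) x
             - Gam E \<omega> \<mu> f (laplacian E \<omega> \<mu> g) x
             - Gam E \<omega> \<mu> (laplacian E \<omega> \<mu> f) g x)"

definition CDE ::
    "('v \<times> 'v) set \<Rightarrow> ('v \<Rightarrow> 'v \<Rightarrow> real) \<Rightarrow> ('v \<Rightarrow> real) \<Rightarrow> real \<Rightarrow> real \<Rightarrow> bool"
  where "CDE E \<omega> \<mu> n K \<longleftrightarrow>
    (\<forall>x f. (\<forall>y. 0 < f y) \<longrightarrow> laplacian E \<omega> \<mu> f x < 0 \<longrightarrow>
      Gam2 E \<omega> \<mu> f f x - Gam E \<omega> \<mu> f (\<lambda>y. Gam E \<omega> \<mu> f f y / f y) x
        \<ge> 1 / n * (laplacian E \<omega> \<mu> f x)\<^sup>2 + K * Gam E \<omega> \<mu> f f x)"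

text \<open>
  Solutions in \<open>[0,T]\<close>; the derivative within \<open>{0..T}\<close> is one-sided at the endpoints. Values of
  \<open>u\<close> and \<open>v\<close> at times outside \<open>[0,T]\<close> are irrelevant.
\<close>

definition is_solution ::
    "('v \<times> 'v) set \<Rightarrow> ('v \<Rightarrow> 'v \<Rightarrow> real) \<Rightarrow> ('v \<Rightarrow> real) \<Rightarrow> real \<Rightarrow> real
      \<Rightarrow> ('v \<Rightarrow> real) \<Rightarrow> ('v \<Rightarrow> real) \<Rightarrow> real
      \<Rightarrow> (real \<Rightarrow> 'v \<Rightarrow> real) \<Rightarrow> (real \<Rightarrow> 'v \<Rightarrow> real) \<Rightarrow> bool"
  where "is_solution E \<omega> \<mu> p q u0 v0 T u v \<longleftrightarrow>
    (\<forall>t\<in>{0..T}. \<forall>x. 0 \<le> u t x \<and> 0 \<le> v t x) \<and>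
    cont_ell_infty T u \<and> cont_ell_infty T v \<and>
    (\<forall>t\<in>{0..T}. \<forall>x.
      ((\<lambda>s. u s x) has_real_derivative (laplacian E \<omega> \<mu> (u t) x + v t x powr p))
        (at t within {0..T}) \<and>
      ((\<lambda>s. v s x) has_real_derivative (laplacian E \<omega> \<mu> (v t) x + u t x powr q))
        (at t within {0..T})) \<and>
    (\<forall>x. u 0 x = u0 x \<and> v 0 x = v0 x)"

definition is_global_solution ::
    "('v \<times> 'v) set \<Rightarrow> ('v \<Rightarrow> 'v \<Rightarrow> real) \<Rightarrow> ('v \<Rightarrow> real) \<Rightarrow> real \<Rightarrow> real
      \<Rightarrow> ('v \<Rightarrow> real) \<Rightarrow> ('v \<Rightarrow> real) \<Rightarrow> real
      \<Rightarrow> (real \<Rightarrow> 'v \<Rightarrow> real) \<Rightarrow> (real \<Rightarrow> 'v \<Rightarrow> real) \<Rightarrow> bool"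
  where "is_global_solution E \<omega> \<mu> p q u0 v0 T u v \<longleftrightarrow>
    (\<exists>U W. (\<forall>t\<in>{0..T}. \<forall>x. U t x = u t x \<and> W t x = v t x) \<and>
      (\<forall>T'>0. is_solution E \<omega> \<mu> p q u0 v0 T' U W))"

end

theory Submission
  imports Defs "HOL-Probability.Discrete_Topology"
begin

text \<open>
  Since \<open>D_mu\<close> is finite, the Laplacian is a bounded operator, so comparison holds for bounded functions
  without any cutoff. With it, \<open>CDE(n,0)\<close> gives a Li--Yau estimate, hence a parabolic Harnack inequality;
  summed over a ball, the volume bound turns it into \<open>g(t) \<le> K S (1 + t) powr (- m/2)\<close> for
  heat solutions \<open>g\<close> of mass \<open>S\<close>.

  Put \<open>\<alpha> = (p+1)/(pq-1)\<close>, \<open>\<beta> = (q+1)/(pq-1)\<close>, \<open>\<kappa> = m/2\<close>, and let \<open>g\<close> be the heat flow of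
  \<open>u0\<^sup>r + v0\<^sup>r\<close> with \<open>r = r2\<close>, the smaller of \<open>\<kappa>/\<alpha>\<close> and \<open>\<kappa>/\<beta>\<close>. If the data are small, explicit
  combinations of powers of \<open>g\<close>, comparable to \<open>g\<close> to the powers \<open>\<alpha>/\<kappa>\<close> and \<open>\<beta>/\<kappa>\<close>, are a
  supersolution of the system that is bounded by 2 for all times. Hence the system with nonlinearities
  truncated at 2, which is a globally Lipschitz equation, has a global solution that never sees the
  truncation; by uniqueness it extends the given one.
\<close>

section \<open>Comparison for bounded functions\<close>

text \<open>The exponents come from scaling: \<alpha> and \<beta> solve p \<beta> = \<alpha> + 1 and
  q \<alpha> = \<beta> + 1, the decay rates at which each time derivative balances its source. The
  hypothesis on m says that \<alpha> and \<beta> are below \<kappa>, so the exponents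
  \<alpha>/\<kappa> and \<beta>/\<kappa> lie below 1, where powers are concave and turn positive
  heat solutions into supersolutions of the heat equation. The obstacle is that the source is
  borderline. For the plain ansatz, a factor depending on t times g^(\<alpha>/\<kappa>), the decay
  of g only reduces the required derivative of the factor to order 1/(1 + t), and such a factor
  grows like a logarithm. Hence the second power of g, with a larger exponent: its growing
  coefficient pays for the source, and the faster decay of the power compensates that growth with no
  logarithm left over.\<close>

lemma positive_derivative_above_level:
  fixes z z' :: "real \<Rightarrow> real"
  assumes "a \<le> t" "continuous_on {a..t} z" "z a \<le> c" "c < z t"
    and deriv: "\<And>s. a < s \<Longrightarrow> s < t \<Longrightarrow> (z has_real_derivative z' s) (at s)"
  obtains s where "a < s" "s < t" "c < z s" "0 < z' s"
proof -
  \<comment> \<open>The last time in this set is where z leaves the level c for good; the mean value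
    theorem from there to t gives the point sought.\<close>
  let ?S = "{s \<in> {a..t}. z s \<le> c}"
  have "closed ?S"
    using continuous_on_closed_Collect_le[OF assms(2) continuous_on_const closed_atLeastAtMost] .
  moreover have "bounded ?S" by (rule bounded_subset[of "{a..t}"]) auto
  ultimately have "compact ?S" by (simp add: compact_eq_bounded_closed)
  moreover have "a \<in> ?S" using assms by auto
  ultimately obtain r where r: "r \<in> ?S" and max: "\<And>s. s \<in> ?S \<Longrightarrow> s \<le> r"
    using compact_attains_sup[of ?S] by auto
  have "r < t" using r assms(4) by (cases "r = t") auto
  have "continuous_on {r..t} z" using assms(2) r by (auto intro: continuous_on_subset)
  moreover have "z differentiable (at s)" if "r < s" "s < t" for s
    using deriv[of s] that r by (auto simp: real_differentiable_def)
  ultimately obtain l s where s: "r < s" "s < t" "DERIV z s :> l" "z t - z r = (t - r) * l"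
    using MVT[OF \<open>r < t\<close>, of z] by auto
  have "l = z' s" using DERIV_unique[OF s(3) deriv[of s]] s r by auto
  moreover have "0 < l"
  proof -
    have "0 < (t - r) * l" using s(4) r assms(4) by simp
    then show ?thesis using \<open>r < t\<close> by (simp add: zero_less_mult_iff)
  qed
  moreover have "c < z s" using max[of s] s r by force
  ultimately show ?thesis using that[of s] s r by auto
qed

text \<open>
  Abstract enough to cover the Laplacian, cooperative systems and differences of solutions; the
  index set need not be compact because the generator is bounded.
\<close>

lemma bounded_maximum_principle:
  fixes w w' :: "real \<Rightarrow> 'i \<Rightarrow> real"
  assumes L: "0 < L"
    and bdd: "\<And>t i. a \<le> t \<Longrightarrow> t \<le> b \<Longrightarrow> w t i \<le> B"
    and init: "\<And>i. w a i \<le> 0"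
    and cont: "\<And>i. continuous_on {a..b} (\<lambda>t. w t i)"
    and deriv: "\<And>t i. a < t \<Longrightarrow> t < b \<Longrightarrow> ((\<lambda>s. w s i) has_real_derivative w' t i) (at t)"
    and step: "\<And>t i K. a < t \<Longrightarrow> t < b \<Longrightarrow> 0 < w t i \<Longrightarrow> (\<And>j. w t j \<le> K) \<Longrightarrow> w' t i \<le> L * K"
    and t: "a \<le> t" "t \<le> b"
  shows "w t i \<le> 0"
proof -
  \<comment> \<open>The damping rate 2 L is twice the growth rate in \<open>step\<close>. Above the
    level K / 2 the damping -2 L z is below -L K and outweighs the growth, so any positive bound K
    can be halved, and iterating gives 0.\<close>
  define z where "z t i = exp (- 2 * L * (t - a)) * w t i" for t i
  have halve: "\<forall>t i. a \<le> t \<longrightarrow> t \<le> b \<longrightarrow> z t i \<le> K / 2"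
    if K: "0 < K" "\<forall>t i. a \<le> t \<longrightarrow> t \<le> b \<longrightarrow> z t i \<le> K" for K
  proof (rule ccontr)
    assume "\<not> ?thesis"
    then obtain t i where ti: "a \<le> t" "t \<le> b" "K / 2 < z t i" by (auto simp: not_le)
    have "continuous_on {a..t} (\<lambda>s. z s i)" unfolding z_def
      using cont[of i] ti by (auto intro!: continuous_intros intro: continuous_on_subset)
    moreover have "z a i \<le> K / 2" using init[of i] K(1) by (simp add: z_def)
    moreover have "((\<lambda>s. z s i) has_real_derivative
        exp (- 2 * L * (s - a)) * w' s i - 2 * L * z s i) (at s)" if "a < s" "s < t" for s
      unfolding z_def using ti that by (auto intro!: derivative_eq_intros deriv)
    ultimately obtain s where s: "a < s" "s < t" "K / 2 < z s i"
        "0 < exp (- 2 * L * (s - a)) * w' s i - 2 * L * z s i"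
      using ti positive_derivative_above_level[of a t "\<lambda>s. z s i" "K / 2"
          "\<lambda>s. exp (- 2 * L * (s - a)) * w' s i - 2 * L * z s i"] by blast
    have "w s j \<le> exp (2 * L * (s - a)) * K" for j
    proof -
      have "w s j = exp (2 * L * (s - a)) * z s j" by (simp add: z_def exp_minus flip: mult.assoc)
      then show ?thesis using K s ti by simp
    qed
    moreover have "0 < w s i"
    proof -
      have "0 < z s i" using s(3) K(1) by linarith
      then show ?thesis by (simp add: z_def zero_less_mult_iff)
    qed
    ultimately have "w' s i \<le> L * (exp (2 * L * (s - a)) * K)"
      using step[of s i] s ti by simp
    then have "exp (- 2 * L * (s - a)) * w' s i
        \<le> exp (- 2 * L * (s - a)) * (L * (exp (2 * L * (s - a)) * K))" by simp
    also have "\<dots> = L * K" by (simp add: exp_minus flip: mult.assoc)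
    also have "\<dots> < 2 * L * z s i" using s(3) L by (simp add: field_simps)
    finally show False using s(4) by simp
  qed
  define K where "K = max B 1"
  have "\<forall>t i. a \<le> t \<longrightarrow> t \<le> b \<longrightarrow> z t i \<le> K / 2 ^ k" for k
  proof (induction k)
    case 0
    have "z t i \<le> K" if "a \<le> t" "t \<le> b" for t i
    proof (cases "w t i \<le> 0")
      case True
      then have "z t i \<le> 0" by (simp add: z_def mult_nonneg_nonpos)
      then show ?thesis by (simp add: K_def)
    next
      case False
      then have "z t i \<le> w t i" using that L by (simp add: z_def mult_le_cancel_right1)
      then show ?thesis using bdd[OF that, of i] by (simp add: K_def)
    qed
    then show ?case by simp
  next
    case (Suc k)
    have "K > 0" by (simp add: K_def)
    then show ?case using halve[OF _ Suc] by (simp add: field_simps)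
  qed
  then have *: "z t i \<le> K / 2 ^ k" for k using t by blast
  have "(\<lambda>k. K * (1 / 2) ^ k) \<longlonglongrightarrow> K * 0"
    by (intro tendsto_intros LIMSEQ_power_zero) simp
  then have "(\<lambda>k. K / 2 ^ k) \<longlonglongrightarrow> 0" by (simp add: field_simps)
  then have "z t i \<le> 0" by (rule LIMSEQ_le_const) (use * in auto)
  then show ?thesis by (simp add: z_def mult_le_0_iff)
qed

section \<open>The heat flow\<close>

locale bounded_degree_graph = weighted_graph E \<omega> \<mu>
  for E :: "('v \<times> 'v) set" and \<omega> :: "'v \<Rightarrow> 'v \<Rightarrow> real" and \<mu> :: "'v \<Rightarrow> real" +
  fixes D :: real
  assumes D_pos: "0 < D"
    and degree_le: "(\<Sum>y | (x, y) \<in> E. \<omega> x y) \<le> D * \<mu> x"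
begin

abbreviation \<Delta> :: "('v \<Rightarrow> real) \<Rightarrow> 'v \<Rightarrow> real"
  where "\<Delta> \<equiv> laplacian E \<omega> \<mu>"

abbreviation nbrs :: "'v \<Rightarrow> 'v set"
  where "nbrs x \<equiv> {y. (x, y) \<in> E}"

definition heat_solution :: "(real \<Rightarrow> 'v \<Rightarrow> real) \<Rightarrow> bool"
  where "heat_solution u \<longleftrightarrow> (\<forall>t x. ((\<lambda>s. u s x) has_real_derivative \<Delta> (u t) x) (at t))"

lemma weight_eq_0: "(x, y) \<notin> E \<Longrightarrow> \<omega> x y = 0"
  using weight_nonneg[of x y] weight_pos_iff[of x y] by linarith

lemma edge_sym: "(x, y) \<in> E \<longleftrightarrow> (y, x) \<in> E"
  by (simp add: weight_pos_iff[symmetric] weight_sym)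

text \<open>Since \<open>f x\<close> is nonnegative, every difference \<open>f y - f x\<close> is at
  most K. This is the form in which the Laplacian enters the premise \<open>step\<close> of the
  maximum principle.\<close>

lemma laplacian_le:
  assumes "\<And>y. f y \<le> K" "0 \<le> f x"
  shows "\<Delta> f x \<le> D * K"
proof -
  have K: "0 \<le> K" using assms order_trans by blast
  have "(\<Sum>y\<in>nbrs x. \<omega> x y * (f y - f x)) \<le> (\<Sum>y\<in>nbrs x. \<omega> x y * K)"
    by (intro sum_mono mult_left_mono weight_nonneg) (use assms in \<open>smt (verit)\<close>)
  also have "\<dots> \<le> D * \<mu> x * K"
    using degree_le[of x] K by (simp add: sum_distrib_right[symmetric] mult_right_mono)
  finally show ?thesis using measure_pos[of x] by (simp add: laplacian_def divide_le_eq mult_ac)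
qed

lemma laplacian_diff: "\<Delta> (\<lambda>y. f y - g y) x = \<Delta> f x - \<Delta> g x"
  unfolding laplacian_def
  by (simp add: diff_divide_distrib[symmetric] sum_subtractf[symmetric])
    (simp add: algebra_simps)

lemma laplacian_add: "\<Delta> (\<lambda>y. f y + g y) x = \<Delta> f x + \<Delta> g x"
  unfolding laplacian_def
  by (simp add: add_divide_distrib[symmetric] sum.distrib[symmetric]) (simp add: algebra_simps)

lemma laplacian_cmult: "\<Delta> (\<lambda>y. c * f y) x = c * \<Delta> f x"
  unfolding laplacian_def by (simp add: sum_distrib_left right_diff_distrib mult_ac)

section \<open>The heat semigroup as a positive power series\<close>

text \<open>The operator D + \<Delta> has nonnegative matrix entries because D bounds the weighted
  degree relative to \<mu>; its powers therefore preserve positivity.\<close>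

definition shifted :: "('v \<Rightarrow> real) \<Rightarrow> 'v \<Rightarrow> real"
  where "shifted f x = D * f x + \<Delta> f x"

lemma shifted_eq:
  "\<mu> x * shifted f x = (\<Sum>y\<in>nbrs x. \<omega> x y * f y) + (D * \<mu> x - (\<Sum>y\<in>nbrs x. \<omega> x y)) * f x"
  using measure_pos[of x]
  by (simp add: shifted_def laplacian_def algebra_simps sum_subtractf sum_distrib_left)

lemma sums_shifted:
  assumes "\<And>y. (\<lambda>k. c k y) sums s y"
  shows "(\<lambda>k. shifted (c k) x) sums shifted s x"
  unfolding shifted_def laplacian_def by (intro sums_add sums_mult sums_sum sums_diff assms)

lemma shifted_nonneg:
  assumes "\<And>x. 0 \<le> f x"
  shows "0 \<le> shifted f x"
proof -
  have "0 \<le> \<mu> x * shifted f x"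
    unfolding shifted_eq using assms degree_le[of x] weight_nonneg by (simp add: sum_nonneg)
  then show ?thesis using measure_pos[of x] by (simp add: zero_le_mult_iff)
qed

lemma shifted_le:
  assumes "\<And>x. f x \<le> B"
  shows "shifted f x \<le> D * B"
proof -
  have "0 \<le> shifted (\<lambda>x. B - f x) x" by (rule shifted_nonneg) (simp add: assms)
  then show ?thesis
    unfolding shifted_def laplacian_diff by (simp add: laplacian_def algebra_simps)
qed

text \<open>By symmetry of \<omega>, column sums of the weights equal row sums, so the operator
  multiplies mass by at most D. Mass is expressed through bounds on all finite partial sums, and F
  is enlarged by its neighbours to contain every vertex that contributes.\<close>

lemma mass_shifted_le:
  assumes f: "\<And>x. 0 \<le> f x" and S: "\<And>F. finite F \<Longrightarrow> (\<Sum>x\<in>F. \<mu> x * f x) \<le> S" and F: "finite F"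
  shows "(\<Sum>x\<in>F. \<mu> x * shifted f x) \<le> D * S"
proof -
  define F' where "F' = F \<union> (\<Union>x\<in>F. nbrs x)"
  have fin: "finite F'" and sub: "F \<subseteq> F'" using F locally_finite by (auto simp: F'_def)
  have deg: "(\<Sum>y\<in>A. \<omega> x y) \<le> (\<Sum>y\<in>nbrs x. \<omega> x y)" if "finite A" for A x
  proof -
    have "(\<Sum>y\<in>A. \<omega> x y) = (\<Sum>y\<in>A \<inter> nbrs x. \<omega> x y)"
      using that by (intro sum.mono_neutral_right) (auto simp: weight_eq_0)
    also have "\<dots> \<le> (\<Sum>y\<in>nbrs x. \<omega> x y)"
      by (intro sum_mono2) (auto simp: locally_finite weight_nonneg)
    finally show ?thesis .
  qed
  have nb: "(\<Sum>y\<in>nbrs x. \<omega> x y * f y) = (\<Sum>y\<in>F'. \<omega> x y * f y)" if "x \<in> F" for x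
    using fin that by (intro sum.mono_neutral_left) (auto simp: F'_def weight_eq_0)
  have "(\<Sum>x\<in>F. \<mu> x * shifted f x)
      = (\<Sum>x\<in>F. \<Sum>y\<in>F'. \<omega> x y * f y) + (\<Sum>x\<in>F. (D * \<mu> x - (\<Sum>y\<in>nbrs x. \<omega> x y)) * f x)"
    unfolding shifted_eq sum.distrib using nb by simp
  also have "(\<Sum>x\<in>F. \<Sum>y\<in>F'. \<omega> x y * f y) = (\<Sum>y\<in>F'. (\<Sum>x\<in>F. \<omega> y x) * f y)"
    by (subst sum.swap) (simp add: sum_distrib_right weight_sym)
  also have "\<dots> \<le> (\<Sum>y\<in>F'. (\<Sum>x\<in>nbrs y. \<omega> y x) * f y)"
    by (intro sum_mono mult_right_mono deg F f)
  also have "(\<Sum>x\<in>F. (D * \<mu> x - (\<Sum>y\<in>nbrs x. \<omega> x y)) * f x)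
      \<le> (\<Sum>x\<in>F'. (D * \<mu> x - (\<Sum>y\<in>nbrs x. \<omega> x y)) * f x)"
    by (intro sum_mono2 fin sub) (use degree_le f in auto)
  finally have "(\<Sum>x\<in>F. \<mu> x * shifted f x) \<le> D * (\<Sum>x\<in>F'. \<mu> x * f x)"
    by (simp add: sum.distrib[symmetric] algebra_simps sum_distrib_left)
  also have "\<dots> \<le> D * S" using S[OF fin] D_pos by simp
  finally show ?thesis .
qed

text \<open>This is exp (- D t) exp (t (D + \<Delta>)) h. With the scalar factor split off, all
  terms are nonnegative for nonnegative h and t, so positivity, upper bound and mass bound follow
  term by term.\<close>

definition heat :: "('v \<Rightarrow> real) \<Rightarrow> real \<Rightarrow> 'v \<Rightarrow> real"
  where "heat h t x = exp (- D * t) * (\<Sum>k. (shifted ^^ k) h x / fact k * t ^ k)"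

context
  fixes h :: "'v \<Rightarrow> real" and B :: real
  assumes h_nonneg: "\<And>x. 0 \<le> h x" and h_le: "\<And>x. h x \<le> B"
begin

lemma shifted_funpow_nonneg: "0 \<le> (shifted ^^ k) h x"
  by (induction k arbitrary: x) (auto simp: h_nonneg shifted_nonneg)

lemma shifted_funpow_le: "(shifted ^^ k) h x \<le> D ^ k * B"
proof (induction k arbitrary: x)
  case (Suc k)
  then show ?case using shifted_le[of "(shifted ^^ k) h" "D ^ k * B" x] by (simp add: mult_ac)
qed (simp add: h_le)

lemma exp_sums: "(\<lambda>k. c ^ k * B / fact k * t ^ k) sums (B * exp (c * t :: real))"
  using sums_mult[OF exp_converges[of "c * t"], of B]
  by (simp add: scaleR_conv_of_real field_simps power_mult_distrib)

lemma heat_summable: "summable (\<lambda>k. (shifted ^^ k) h x / fact k * t ^ k)"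
proof (rule summable_comparison_test)
  show "summable (\<lambda>k. D ^ k * B / fact k * \<bar>t\<bar> ^ k)" using exp_sums by (rule sums_summable)
  show "\<exists>N. \<forall>k\<ge>N. norm ((shifted ^^ k) h x / fact k * t ^ k) \<le> D ^ k * B / fact k * \<bar>t\<bar> ^ k"
    using shifted_funpow_nonneg shifted_funpow_le
    by (auto simp: abs_mult power_abs intro!: mult_right_mono divide_right_mono)
qed

lemma heat_sums:
  "(\<lambda>k. (shifted ^^ k) h x / fact k * t ^ k) sums (exp (D * t) * heat h t x)"
  using summable_sums[OF heat_summable[of x t]] by (simp add: heat_def exp_minus flip: mult.assoc)

lemma heat_0: "heat h 0 x = h x"
  using sums_unique2[OF heat_sums[of x 0] powser_sums_zero[of "\<lambda>k. (shifted ^^ k) h x / fact k"]]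
  by simp

lemma heat_nonneg:
  assumes "0 \<le> t"
  shows "0 \<le> heat h t x"
proof -
  have "0 \<le> exp (D * t) * heat h t x"
    by (rule sums_le[OF _ sums_zero heat_sums]) (use assms shifted_funpow_nonneg in simp)
  then show ?thesis by (simp add: zero_le_mult_iff not_le[symmetric])
qed

lemma heat_le:
  assumes "0 \<le> t"
  shows "heat h t x \<le> B"
proof -
  have "exp (D * t) * heat h t x \<le> B * exp (D * t)"
    by (rule sums_le[OF _ heat_sums exp_sums])
      (use assms shifted_funpow_le in \<open>auto intro!: mult_right_mono divide_right_mono\<close>)
  then show ?thesis by (simp add: mult.commute)
qed

lemma heat_mass_le:
  assumes t: "0 \<le> t" and S: "\<And>F. finite F \<Longrightarrow> (\<Sum>x\<in>F. \<mu> x * h x) \<le> S" and F: "finite F"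
  shows "(\<Sum>x\<in>F. \<mu> x * heat h t x) \<le> S"
proof -
  have mass: "(\<Sum>x\<in>F. \<mu> x * (shifted ^^ k) h x) \<le> D ^ k * S" if "finite F" for k F
    using that
  proof (induction k arbitrary: F)
    case (Suc k)
    then show ?case
      using mass_shifted_le[of "(shifted ^^ k) h" "D ^ k * S" F] shifted_funpow_nonneg
      by (simp add: mult_ac)
  qed (simp add: S)
  have "(\<lambda>k. \<Sum>x\<in>F. \<mu> x * ((shifted ^^ k) h x / fact k * t ^ k))
      sums (\<Sum>x\<in>F. \<mu> x * (exp (D * t) * heat h t x))"
    by (intro sums_sum sums_mult heat_sums)
  moreover have "(\<lambda>k. D ^ k * S / fact k * t ^ k) sums (S * exp (D * t))"
    using sums_mult[OF exp_converges[of "D * t"], of S]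
    by (simp add: scaleR_conv_of_real field_simps power_mult_distrib)
  moreover have "(\<Sum>x\<in>F. \<mu> x * ((shifted ^^ k) h x / fact k * t ^ k)) \<le> D ^ k * S / fact k * t ^ k"
    for k
  proof -
    have "(\<Sum>x\<in>F. \<mu> x * ((shifted ^^ k) h x / fact k * t ^ k))
        = (\<Sum>x\<in>F. \<mu> x * (shifted ^^ k) h x) / fact k * t ^ k"
      by (simp add: sum_distrib_right sum_divide_distrib mult.assoc)
    also have "\<dots> \<le> D ^ k * S / fact k * t ^ k"
      using mass[OF F, of k] t by (intro mult_right_mono divide_right_mono) auto
    finally show ?thesis .
  qed
  ultimately have "(\<Sum>x\<in>F. \<mu> x * (exp (D * t) * heat h t x)) \<le> S * exp (D * t)"
    by (rule sums_le[rotated])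
  then have "exp (D * t) * (\<Sum>x\<in>F. \<mu> x * heat h t x) \<le> exp (D * t) * S"
    by (simp add: sum_distrib_left mult_ac)
  then show ?thesis by simp
qed

text \<open>The series converges for every real t, so it may be differentiated termwise and the
  derivative is two-sided at time 0 as well.\<close>

lemma heat_solution_heat: "heat_solution (heat h)"
  unfolding heat_solution_def
proof (intro allI)
  fix t x
  define s where "s t x = (\<Sum>k. (shifted ^^ k) h x / fact k * t ^ k)" for t x
  have s: "(\<lambda>k. (shifted ^^ k) h x / fact k * t ^ k) sums s t x" for t x
    using summable_sums[OF heat_summable] by (simp add: s_def)
  have heat_s: "heat h t x = exp (- D * t) * s t x" for t x by (simp add: heat_def s_def)
  have "((\<lambda>t. s t x) has_real_derivative
      (\<Sum>k. diffs (\<lambda>k. (shifted ^^ k) h x / fact k) k * t ^ k)) (at t)"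
    unfolding s_def by (rule termdiffs_strong_converges_everywhere) (rule heat_summable)
  \<comment> \<open>Differentiation moves the coefficients by one index, which amounts to one more
    application of \<open>shifted\<close>.\<close>
  moreover have "(\<lambda>k. diffs (\<lambda>k. (shifted ^^ k) h x / fact k) k * t ^ k) sums shifted (s t) x"
  proof -
    have "(\<lambda>k. shifted (\<lambda>x. (shifted ^^ k) h x / fact k * t ^ k) x) sums shifted (s t) x"
      by (rule sums_shifted) (rule s)
    moreover have "shifted (\<lambda>x. (shifted ^^ k) h x / fact k * t ^ k) x
        = diffs (\<lambda>k. (shifted ^^ k) h x / fact k) k * t ^ k" for k
    proof -
      have "shifted (\<lambda>x. c * f x) x = c * shifted f x" for c f
        by (simp add: shifted_def laplacian_cmult algebra_simps)
      from this[of "t ^ k / fact k" "(shifted ^^ k) h"] show ?thesis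
        by (simp add: diffs_def fact_Suc del: of_nat_Suc) (simp add: field_simps)
    qed
    ultimately show ?thesis by simp
  qed
  ultimately have "((\<lambda>t. s t x) has_real_derivative shifted (s t) x) (at t)"
    by (simp add: sums_iff)
  then have "((\<lambda>t. heat h t x) has_real_derivative
      - D * exp (- D * t) * s t x + exp (- D * t) * shifted (s t) x) (at t)"
    unfolding heat_s by (auto intro!: derivative_eq_intros)
  moreover have "\<Delta> (heat h t) x = exp (- D * t) * \<Delta> (s t) x"
    unfolding heat_s by (rule laplacian_cmult)
  ultimately show "((\<lambda>t. heat h t x) has_real_derivative \<Delta> (heat h t) x) (at t)"
    by (simp add: shifted_def algebra_simps)
qed

end

end

section \<open>The Li--Yau estimate\<close>

context bounded_degree_graph
begin

abbreviation \<Gamma> :: "('v \<Rightarrow> real) \<Rightarrow> ('v \<Rightarrow> real) \<Rightarrow> 'v \<Rightarrow> real"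
  where "\<Gamma> \<equiv> Gam E \<omega> \<mu>"

lemma Gam_commute: "\<Gamma> f g x = \<Gamma> g f x"
  unfolding Gam_def by (simp add: mult_ac)

lemma Gam_add_right: "\<Gamma> f (\<lambda>y. g y + k y) x = \<Gamma> f g x + \<Gamma> f k x"
proof -
  have "(\<Sum>y\<in>nbrs x. \<omega> x y * (f y - f x) * (g y + k y - (g x + k x)))
      = (\<Sum>y\<in>nbrs x. \<omega> x y * (f y - f x) * (g y - g x))
        + (\<Sum>y\<in>nbrs x. \<omega> x y * (f y - f x) * (k y - k x))"
    unfolding sum.distrib[symmetric] by (intro sum.cong refl) (simp add: algebra_simps)
  then show ?thesis unfolding Gam_def by (simp add: distrib_left)
qed

text \<open>An exact substitute for the chain rule. It is the reason why the Li--Yau argument is run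
  on the square root of u rather than on its logarithm.\<close>

lemma laplacian_square: "\<Delta> (\<lambda>y. (f y)\<^sup>2) x = 2 * (f x * \<Delta> f x) + 2 * \<Gamma> f f x"
proof -
  have "(\<Sum>y\<in>nbrs x. \<omega> x y * ((f y)\<^sup>2 - (f x)\<^sup>2))
      = 2 * f x * (\<Sum>y\<in>nbrs x. \<omega> x y * (f y - f x))
        + (\<Sum>y\<in>nbrs x. \<omega> x y * (f y - f x) * (f y - f x))"
    unfolding sum_distrib_left sum.distrib[symmetric]
    by (intro sum.cong refl) (simp add: algebra_simps power2_eq_square)
  then show ?thesis
    unfolding laplacian_def Gam_def using measure_pos[of x] by (simp add: field_simps)
qed

lemma has_derivative_laplacian:
  assumes "\<And>y. ((\<lambda>s. f s y) has_real_derivative f' y) (at t)"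
  shows "((\<lambda>s. \<Delta> (f s) x) has_real_derivative \<Delta> f' x) (at t)"
  unfolding laplacian_def by (intro DERIV_cmult DERIV_sum DERIV_diff assms)

lemma has_derivative_Gam:
  assumes "\<And>y. ((\<lambda>s. f s y) has_real_derivative f' y) (at t)"
  shows "((\<lambda>s. \<Gamma> (f s) (f s) x) has_real_derivative 2 * \<Gamma> (f t) f' x) (at t)"
proof -
  have "((\<lambda>s. \<omega> x y * (f s y - f s x) * (f s y - f s x)) has_real_derivative
      2 * (\<omega> x y * (f t y - f t x) * (f' y - f' x))) (at t)" for y
    by (auto intro!: derivative_eq_intros assms simp: algebra_simps)
  then have "((\<lambda>s. 1 / (2 * \<mu> x) * (\<Sum>y\<in>nbrs x. \<omega> x y * (f s y - f s x) * (f s y - f s x)))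
      has_real_derivative 1 / (2 * \<mu> x) *
        (\<Sum>y\<in>nbrs x. 2 * (\<omega> x y * (f t y - f t x) * (f' y - f' x)))) (at t)"
    by (intro DERIV_cmult DERIV_sum)
  then show ?thesis by (simp add: Gam_def sum_distrib_left mult_ac)
qed

lemma neg_laplacian_le:
  assumes "\<And>y. 0 \<le> f y"
  shows "- \<Delta> f x \<le> D * f x"
  using shifted_nonneg[of f x] assms by (simp add: shifted_def)

end

text \<open>
  With \<open>f = sqrt u\<close> and \<open>H = - f \<Delta> f\<close>, the condition \<open>CDE(n,0)\<close> says that
  \<open>(\<Delta> - \<partial>\<^sub>t) H \<ge> (2/n) H\<^sup>2 / u\<close> wherever \<open>H > 0\<close>, and \<open>G = n u / (2 t)\<close> solves this with equality.
  For \<open>t \<le> n / (2 D)\<close> the bound \<open>H \<le> D u \<le> G\<close> is trivial, and comparison does the rest.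
\<close>

lemma (in bounded_degree_graph) li_yau:
  assumes n: "0 < n" and cde: "CDE E \<omega> \<mu> n 0"
    and u: "heat_solution u"
    and u_pos: "\<And>t x. 0 \<le> t \<Longrightarrow> 0 < u t x" and u_le: "\<And>t x. 0 \<le> t \<Longrightarrow> u t x \<le> B"
    and t: "0 < t"
  shows "2 * \<Gamma> (\<lambda>y. sqrt (u t y)) (\<lambda>y. sqrt (u t y)) x - n * u t x / t \<le> \<Delta> (u t) x"
proof -
  define f where "f t y = sqrt (u t y)" for t y
  define H where "H t x = \<Gamma> (f t) (f t) x - \<Delta> (u t) x / 2" for t x
  define f' where "f' t y = \<Delta> (u t) y / (2 * f t y)" for t y
  define H' where "H' t x = 2 * \<Gamma> (f t) (f' t) x - \<Delta> (\<Delta> (u t)) x / 2" for t x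
  define W where "W t x = H t x - n / (2 * t) * u t x" for t x
  define W' where "W' t x = H' t x - n / (2 * t) * \<Delta> (u t) x + n / (2 * t\<^sup>2) * u t x" for t x
  have f_pos: "0 < f t y" and f_sq: "(f t y)\<^sup>2 = u t y" if "0 \<le> t" for t y
    using u_pos[OF that, of y] by (auto simp: f_def)
  have lap_u: "\<Delta> (u t) x = 2 * (f t x * \<Delta> (f t) x) + 2 * \<Gamma> (f t) (f t) x" if "0 \<le> t" for t x
    using laplacian_square[of "f t" x] f_sq[OF that] by simp
  have H_eq: "H t x = - f t x * \<Delta> (f t) x" if "0 \<le> t" for t x
    by (simp add: H_def lap_u[OF that] add_divide_distrib)
  have H_le: "H t x \<le> D * u t x" if "0 \<le> t" for t x
  proof -
    have "f t x * (- \<Delta> (f t) x) \<le> f t x * (D * f t x)"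
      using f_pos[OF that] by (intro mult_left_mono neg_laplacian_le) (auto simp: less_imp_le)
    then have "H t x \<le> f t x * (D * f t x)" by (simp add: H_eq[OF that])
    then show ?thesis using f_sq[OF that, of x] by (simp add: power2_eq_square mult_ac)
  qed
  have u': "((\<lambda>s. u s y) has_real_derivative \<Delta> (u t) y) (at t)" for t y
    using u by (simp add: heat_solution_def)
  have df: "((\<lambda>s. f s y) has_real_derivative f' t y) (at t)" if "0 < t" for t y
    unfolding f_def f'_def using u_pos[of t y] that
    by (auto intro!: derivative_eq_intros u' simp: field_simps)
  have dH: "((\<lambda>s. H s x) has_real_derivative H' t x) (at t)" if "0 < t" for t x
    unfolding H_def H'_def using that
    by (intro DERIV_diff DERIV_cdivide has_derivative_Gam has_derivative_laplacian df u')
  have dW: "((\<lambda>s. W s x) has_real_derivative W' t x) (at t)" if "0 < t" for t x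
    unfolding W_def W'_def using that
    by (auto intro!: derivative_eq_intros dH u' simp: field_simps power2_eq_square)
  \<comment> \<open>The time derivative of f is \<Delta> f + \<Gamma>(f)/f, so the evolution of the
    square root creates exactly the gradient term subtracted in \<open>CDE\<close>; the two
    contributions \<Delta> \<Delta> u / 2 cancel.\<close>
  have key: "\<Delta> (H t) x - H' t x
      = 2 * (Gam2 E \<omega> \<mu> (f t) (f t) x - \<Gamma> (f t) (\<lambda>y. \<Gamma> (f t) (f t) y / f t y) x)"
    if "0 \<le> t" for t x
  proof -
    have "f' t = (\<lambda>y. \<Delta> (f t) y + \<Gamma> (f t) (f t) y / f t y)"
    proof (rule ext)
      fix y
      show "f' t y = \<Delta> (f t) y + \<Gamma> (f t) (f t) y / f t y"
        unfolding f'_def lap_u[OF that] using f_pos[OF that, of y] by (simp add: field_simps)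
    qed
    then have "\<Gamma> (f t) (f' t) x
        = \<Gamma> (f t) (\<Delta> (f t)) x + \<Gamma> (f t) (\<lambda>y. \<Gamma> (f t) (f t) y / f t y) x"
      by (simp add: Gam_add_right)
    moreover have "\<Delta> (H t) x = \<Delta> (\<Gamma> (f t) (f t)) x - \<Delta> (\<Delta> (u t)) x / 2"
      using laplacian_diff[of "\<Gamma> (f t) (f t)" "\<lambda>y. 1 / 2 * \<Delta> (u t) y" x]
        laplacian_cmult[of "1 / 2" "\<Delta> (u t)" x]
      by (simp add: H_def[abs_def])
    ultimately show ?thesis
      by (simp add: H'_def Gam2_def Gam_commute[of "\<Delta> (f t)"])
  qed
  have W_le: "W t x \<le> 0"
  proof (cases "t \<le> n / (2 * D)")
    case True
    then have "D \<le> n / (2 * t)" using t D_pos by (simp add: field_simps)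
    then have "D * u t x \<le> n / (2 * t) * u t x" using u_pos[of t x] t by (intro mult_right_mono) auto
    then show ?thesis using H_le[of t x] t by (simp add: W_def)
  next
    case False
    \<comment> \<open>At this time n / (2 t) equals D, so \<open>H_le\<close> supplies the initial
      condition for W.\<close>
    define t0 where "t0 = n / (2 * D)"
    have t0: "0 < t0" "t0 \<le> t" using n D_pos False by (auto simp: t0_def)
    show ?thesis
    proof (rule bounded_maximum_principle[where w = W and a = t0 and b = t and w' = W' and L = D and B = "D * B"])
      show "0 < D" by (rule D_pos)
      show "W s y \<le> D * B" if "t0 \<le> s" "s \<le> t" for s y
      proof -
        have "0 \<le> n / (2 * s) * u s y" using n t0 that u_pos[of s y] by simp
        moreover have "D * u s y \<le> D * B" using u_le[of s y] D_pos t0 that by simp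
        ultimately show ?thesis using H_le[of s y] t0 that unfolding W_def by linarith
      qed
      show "W t0 y \<le> 0" for y
        using H_le[of t0 y] t0 D_pos n by (simp add: W_def) (simp add: t0_def mult.commute)
      show "continuous_on {t0..t} (\<lambda>s. W s y)" for y
        using t0 by (intro continuous_at_imp_continuous_on ballI DERIV_isCont[OF dW]) auto
      show "((\<lambda>s. W s y) has_real_derivative W' s y) (at s)" if "t0 < s" "s < t" for s y
        using t0 that by (intro dW) auto
      show "W' s y \<le> D * K" if s: "t0 < s" "s < t" and pos: "0 < W s y" and K: "\<And>z. W s z \<le> K"
        for s y K
      proof -
        have s0: "0 < s" "0 \<le> s" using s t0 by auto
        note f = f_pos[OF s0(2), of y] and fs = f_sq[OF s0(2), of y]
        \<comment> \<open>Positivity of W forces -\<Delta> f > n f / (2 s) > 0. This makes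
          \<open>CDE\<close> applicable, and twice its quadratic term is then at least n u / (2
          s^2), which is what differentiating the coefficient n / (2 s) costs.\<close>
        have "n / (2 * s) * (f s y)\<^sup>2 < - f s y * \<Delta> (f s) y"
          using pos by (simp add: W_def H_eq[OF s0(2)] fs)
        then have "f s y * (n / (2 * s) * f s y) < f s y * (- \<Delta> (f s) y)"
          by (simp add: power2_eq_square mult_ac)
        then have lt: "n / (2 * s) * f s y < - \<Delta> (f s) y" using f by (simp only: mult_less_cancel_left_pos)
        moreover have nf: "0 < n / (2 * s) * f s y" using n s0 f by simp
        ultimately have neg: "\<Delta> (f s) y < 0" by linarith
        have "(n / (2 * s) * f s y)\<^sup>2 \<le> (- \<Delta> (f s) y)\<^sup>2"
          using lt nf by (intro power_mono) auto
        then have "2 / n * (n / (2 * s) * f s y)\<^sup>2 \<le> 2 / n * (\<Delta> (f s) y)\<^sup>2"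
          using n by (intro mult_left_mono) auto
        also have "2 / n * (n / (2 * s) * f s y)\<^sup>2 = n / (2 * s\<^sup>2) * u s y"
          using n s0 fs by (simp add: power_mult_distrib field_simps power2_eq_square)
        also have "2 / n * (\<Delta> (f s) y)\<^sup>2 = 2 * (1 / n * (\<Delta> (f s) y)\<^sup>2)" by simp
        also have "\<dots> \<le> 2 * (Gam2 E \<omega> \<mu> (f s) (f s) y - \<Gamma> (f s) (\<lambda>y. \<Gamma> (f s) (f s) y / f s y) y)"
          using cde neg f_pos[OF s0(2)] by (intro mult_left_mono) (auto simp: CDE_def)
        also have "\<dots> = \<Delta> (H s) y - H' s y" by (rule key[OF s0(2), symmetric])
        finally have "H' s y + n / (2 * s\<^sup>2) * u s y \<le> \<Delta> (H s) y" by simp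
        moreover have "\<Delta> (W s) y = \<Delta> (H s) y - n / (2 * s) * \<Delta> (u s) y"
          using laplacian_diff[of "H s" "\<lambda>y. n / (2 * s) * u s y" y]
            laplacian_cmult[of "n / (2 * s)" "u s" y]
          by (simp only: W_def[abs_def])
        moreover have "\<Delta> (W s) y \<le> D * K" using K pos by (intro laplacian_le) auto
        ultimately show ?thesis unfolding W'_def by linarith
      qed
    qed (use t0 in auto)
  qed
  then have "2 * \<Gamma> (f t) (f t) x - n * u t x / t \<le> \<Delta> (u t) x"
    by (simp add: W_def H_def)
  then show ?thesis by (simp add: f_def[abs_def])
qed

section \<open>Harnack inequality and decay of the heat flow\<close>

text \<open>Converts differences of logarithms, which the Harnack inequality is about, into
  differences of square roots, which the gradient term in Li--Yau controls.\<close>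

lemma sqrt_ratio_ge_half_log:
  assumes "0 < a" "0 < b"
  shows "(ln a - ln b) / 2 \<le> sqrt a / sqrt b - 1"
proof -
  have "(ln a - ln b) / 2 = ln (sqrt a / sqrt b)"
    using assms by (simp add: ln_div ln_sqrt)
  also have "\<dots> \<le> sqrt a / sqrt b - 1"
    using assms by (intro ln_le_minus_one) simp
  finally show ?thesis .
qed

text \<open>The constant c bounds the jump rate \<open>\<omega> x y / \<mu> x\<close> along every
  edge from below, so that \<Gamma> at a vertex controls the difference along each single
  edge.\<close>

locale nonneg_curved_graph = bounded_degree_graph E \<omega> \<mu> D
  for E :: "('v \<times> 'v) set" and \<omega> :: "'v \<Rightarrow> 'v \<Rightarrow> real" and \<mu> :: "'v \<Rightarrow> real" and D :: real +
  fixes n c :: real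
  assumes n_pos: "0 < n" and c_pos: "0 < c"
    and curv: "CDE E \<omega> \<mu> n 0"
    and weight_ge: "(x, y) \<in> E \<Longrightarrow> c * \<mu> x \<le> \<omega> x y"
begin

lemma Gam_ge:
  assumes "(x, y) \<in> E"
  shows "c * (f y - f x)\<^sup>2 \<le> 2 * \<Gamma> f f x"
proof -
  have "c * \<mu> x * (f y - f x)\<^sup>2 \<le> \<omega> x y * (f y - f x)\<^sup>2"
    by (intro mult_right_mono weight_ge assms) simp
  also have "\<dots> \<le> (\<Sum>z\<in>nbrs x. \<omega> x z * (f z - f x)\<^sup>2)"
    using assms by (intro member_le_sum[of y]) (auto simp: locally_finite weight_nonneg)
  finally show ?thesis
    using measure_pos[of x] by (simp add: Gam_def field_simps power2_eq_square mult.assoc)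
qed

lemma Gam_nonneg: "0 \<le> \<Gamma> f f x"
  using measure_pos[of x] by (simp add: Gam_def mult.assoc sum_nonneg weight_nonneg)

context
  fixes u :: "real \<Rightarrow> 'v \<Rightarrow> real" and B :: real
  assumes u: "heat_solution u"
    and u_pos: "\<And>t x. 0 \<le> t \<Longrightarrow> 0 < u t x" and u_le: "\<And>t x. 0 \<le> t \<Longrightarrow> u t x \<le> B"
begin

text \<open>The summand n ln t absorbs the term n / t of the Li--Yau estimate: \<open>logu x\<close>
  is nondecreasing in time and its derivative dominates the gradient term.\<close>

definition logu :: "'v \<Rightarrow> real \<Rightarrow> real"
  where "logu x t = n * ln t + ln (u t x)"

definition logu' :: "'v \<Rightarrow> real \<Rightarrow> real"
  where "logu' x t = n / t + \<Delta> (u t) x / u t x"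

lemma logu_deriv: "0 < t \<Longrightarrow> (logu x has_real_derivative logu' x t) (at t)"
  unfolding logu_def[abs_def] logu'_def using u u_pos[of t x]
  by (auto intro!: derivative_eq_intros simp: heat_solution_def)

lemma logu'_ge:
  assumes "0 < t"
  shows "2 * \<Gamma> (\<lambda>y. sqrt (u t y)) (\<lambda>y. sqrt (u t y)) x / u t x \<le> logu' x t"
proof -
  have "2 * \<Gamma> (\<lambda>y. sqrt (u t y)) (\<lambda>y. sqrt (u t y)) x \<le> n * u t x / t + \<Delta> (u t) x"
    using li_yau[OF n_pos curv u u_pos u_le assms, of x] by simp
  then show ?thesis
    using u_pos[of t x] assms by (simp add: logu'_def field_simps)
qed

lemma logu'_nonneg: "0 < t \<Longrightarrow> 0 \<le> logu' x t"
  by (rule order_trans[OF _ logu'_ge]) (use u_pos[of t x] Gam_nonneg in auto)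

lemma logu_mono:
  assumes "0 < s" "s \<le> t"
  shows "logu x s \<le> logu x t"
  using assms by (intro DERIV_nonneg_imp_nondecreasing[OF assms(2)]) (meson logu_deriv logu'_nonneg order.strict_trans2)

text \<open>
  While \<open>\<delta>(s) = logu x T1 - logu y s\<close> is positive, \<open>\<delta>' \<le> - c \<delta>\<^sup>2 / 4\<close>, since \<open>\<delta>(s) / 2\<close> is at most
  \<open>sqrt (u s x / u s y) - 1\<close>, which is controlled by the gradient term at \<open>y\<close>.
\<close>

lemma harnack_edge:
  assumes xy: "(x, y) \<in> E" and T: "0 < T1" "T1 < T2"
  shows "logu x T1 \<le> logu y T2 + 4 / (c * (T2 - T1))"
proof (rule ccontr)
  assume "\<not> ?thesis"
  then have neg: "4 / (c * (T2 - T1)) < logu x T1 - logu y T2" by simp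
  define \<delta> where "\<delta> s = logu x T1 - logu y s" for s
  have "0 < 4 / (c * (T2 - T1))" using T c_pos by simp
  then have \<delta>_T2: "0 < \<delta> T2" using neg unfolding \<delta>_def by linarith
  have \<delta>_pos: "0 < \<delta> s" if "T1 \<le> s" "s \<le> T2" for s
    using logu_mono[of s T2 y] that T \<delta>_T2 by (simp add: \<delta>_def)
  have slope: "c / 4 * (\<delta> s)\<^sup>2 \<le> logu' y s" if s: "T1 \<le> s" "s \<le> T2" for s
  proof -
    have s0: "0 < s" using s T by simp
    have pos: "0 < u s x" "0 < u s y" using u_pos s0 by auto
    have "\<delta> s \<le> logu x s - logu y s" using logu_mono[of T1 s x] s T by (simp add: \<delta>_def)
    also have "\<dots> = ln (u s x) - ln (u s y)" by (simp add: logu_def)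
    finally have "\<delta> s / 2 \<le> (ln (u s x) - ln (u s y)) / 2" by simp
    also have "\<dots> \<le> sqrt (u s x) / sqrt (u s y) - 1" by (rule sqrt_ratio_ge_half_log[OF pos])
    finally have "\<delta> s / 2 \<le> sqrt (u s x) / sqrt (u s y) - 1" .
    then have "(\<delta> s / 2)\<^sup>2 \<le> (sqrt (u s x) / sqrt (u s y) - 1)\<^sup>2"
      using \<delta>_pos[OF s] by (intro power_mono) auto
    also have "\<dots> = (sqrt (u s x) - sqrt (u s y))\<^sup>2 / u s y"
    proof -
      have "sqrt (u s x) / sqrt (u s y) - 1 = (sqrt (u s x) - sqrt (u s y)) / sqrt (u s y)"
        using pos by (simp add: field_simps)
      then show ?thesis using pos by (simp add: power_divide)
    qed
    finally have "c * (\<delta> s / 2)\<^sup>2 \<le> c * (sqrt (u s x) - sqrt (u s y))\<^sup>2 / u s y"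
      using c_pos by (simp flip: times_divide_eq_right)
    also have "\<dots> \<le> 2 * \<Gamma> (\<lambda>z. sqrt (u s z)) (\<lambda>z. sqrt (u s z)) y / u s y"
      using Gam_ge[of y x "\<lambda>z. sqrt (u s z)"] xy edge_sym[of x y] pos
      by (intro divide_right_mono) auto
    also have "\<dots> \<le> logu' y s" by (rule logu'_ge[OF s0])
    finally show ?thesis by (simp add: power_divide)
  qed
  \<comment> \<open>The reciprocal integrates the Riccati inequality: 1/\<delta> grows at rate at
    least c / 4. Dropping the positive term 1/\<delta>(T1) bounds \<delta>(T2) whatever the size of
    \<delta>(T1).\<close>
  have "((\<lambda>s. 1 / \<delta> s - c / 4 * s) has_real_derivative logu' y s / (\<delta> s)\<^sup>2 - c / 4) (at s)
      \<and> 0 \<le> logu' y s / (\<delta> s)\<^sup>2 - c / 4" if "T1 \<le> s" "s \<le> T2" for s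
  proof
    have "(\<delta> has_real_derivative - logu' y s) (at s)"
      unfolding \<delta>_def[abs_def] using that T by (auto intro!: derivative_eq_intros logu_deriv)
    then show "((\<lambda>s. 1 / \<delta> s - c / 4 * s) has_real_derivative logu' y s / (\<delta> s)\<^sup>2 - c / 4) (at s)"
      using \<delta>_pos[OF that] by (auto intro!: derivative_eq_intros simp: power2_eq_square)
    show "0 \<le> logu' y s / (\<delta> s)\<^sup>2 - c / 4"
      using slope[OF that] \<delta>_pos[OF that] by (simp add: field_simps)
  qed
  then have "\<exists>d. ((\<lambda>s. 1 / \<delta> s - c / 4 * s) has_real_derivative d) (at s) \<and> 0 \<le> d"
    if "T1 \<le> s" "s \<le> T2" for s using that by blast
  then have "1 / \<delta> T1 - c / 4 * T1 \<le> 1 / \<delta> T2 - c / 4 * T2"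
    by (rule DERIV_nonneg_imp_nondecreasing[OF less_imp_le[OF T(2)]])
  moreover have "0 < 1 / \<delta> T1" using \<delta>_pos[of T1] T by simp
  ultimately have "c / 4 * (T2 - T1) \<le> 1 / \<delta> T2" unfolding right_diff_distrib by linarith
  then have "\<delta> T2 \<le> 4 / (c * (T2 - T1))"
    using \<delta>_T2 c_pos T by (simp add: field_simps)
  then show False using neg unfolding \<delta>_def by linarith
qed

lemma harnack_path:
  assumes "(x, y) \<in> E ^^ k" "0 < T" "0 < \<tau>"
  shows "logu x T \<le> logu y (T + real k * \<tau>) + real k * (4 / (c * \<tau>))"
  using assms(1)
proof (induction k arbitrary: y)
  case (Suc k)
  then obtain z where z: "(x, z) \<in> E ^^ k" "(z, y) \<in> E" by auto
  have "logu z (T + real k * \<tau>) \<le> logu y (T + real (Suc k) * \<tau>)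
      + 4 / (c * (T + real (Suc k) * \<tau> - (T + real k * \<tau>)))"
    by (rule harnack_edge[OF z(2)]) (use assms in \<open>auto intro: add_pos_nonneg\<close>)
  moreover have "T + real (Suc k) * \<tau> - (T + real k * \<tau>) = \<tau>" by (simp add: algebra_simps)
  ultimately show ?case using Suc.IH[OF z(1)] by (simp add: algebra_simps add_divide_distrib)
qed simp

text \<open>A walk of k edges with equal time steps t / k costs 4 k^2 / (c t), at most 4 / c on the
  parabolic scale. The factor \<open>2 powr n\<close> is the change of n ln t between the times t
  and 2 t.\<close>

lemma harnack_parabolic:
  assumes k: "(x, y) \<in> E ^^ k" "(real k)\<^sup>2 \<le> t" and t: "0 < t"
  shows "u t x \<le> 2 powr n * exp (4 / c) * u (2 * t) y"
proof -
  have "logu x t \<le> logu y (2 * t) + 4 / c"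
  proof (cases "k = 0")
    case True
    then have "logu x t \<le> logu y (2 * t)" using k logu_mono[of t "2 * t" x] t by simp
    then show ?thesis using c_pos by (smt (verit) divide_pos_pos)
  next
    case False
    have "real k * (4 / (c * (t / real k))) = (real k)\<^sup>2 / t * (4 / c)"
      by (simp add: power2_eq_square mult_ac)
    also have "\<dots> \<le> 1 * (4 / c)"
      using k(2) t c_pos by (intro mult_right_mono) auto
    finally show ?thesis
      using harnack_path[OF k(1) t, of "t / real k"] False t by simp
  qed
  then have "ln (u t x) \<le> n * ln 2 + 4 / c + ln (u (2 * t) y)"
    using t by (simp add: logu_def ln_mult algebra_simps)
  then have "exp (ln (u t x)) \<le> exp (n * ln 2 + 4 / c + ln (u (2 * t) y))" by simp
  then show ?thesis
    using u_pos[of t x] u_pos[of "2 * t" y] t by (simp add: exp_add powr_def)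
qed

end

section \<open>Decay by averaging the Harnack inequality over a ball\<close>

lemma heat_solution_add_const:
  assumes "heat_solution u"
  shows "heat_solution (\<lambda>t x. u t x + \<epsilon>)"
proof -
  have "\<Delta> (\<lambda>y. f y + \<epsilon>) x = \<Delta> f x" for f x by (simp add: laplacian_def)
  then show ?thesis
    using assms by (auto simp: heat_solution_def intro!: derivative_eq_intros)
qed

lemma connected_gdist: "(x, y) \<in> E ^^ gdist E x y"
  unfolding gdist_def using rtrancl_imp_relpow[OF connected_verts[of x y]]
  by (metis LeastI_ex)

text \<open>The value at (t, x) is at most a constant times the value at (2 t, y) for every y in the
  ball of radius sqrt t; summing over the ball brings in the mass at time 2 t, which is at most
  S.\<close>

lemma heat_decay:
  assumes h: "\<And>x. 0 \<le> h x" "\<And>x. h x \<le> B"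
    and S: "\<And>F. finite F \<Longrightarrow> (\<Sum>x\<in>F. \<mu> x * h x) \<le> S"
    and vol: "volume E \<mu> x (sqrt t) \<ge> v" "0 < v" and t: "0 < t"
  shows "heat h t x \<le> 2 powr n * exp (4 / c) * S / v"
proof -
  let ?C = "2 powr n * exp (4 / c)" and ?b = "gball E x (sqrt t)"
  \<comment> \<open>A sum over an infinite set is 0, so an infinite ball would have volume 0,
    against v > 0.\<close>
  have fin: "finite ?b" using vol by (auto simp: volume_def intro: ccontr)
  have le: "heat h t x \<le> ?C * heat h (2 * t) y" if y: "y \<in> ?b" for y
  proof (rule field_le_epsilon)
    fix e :: real assume e: "0 < e"
    \<comment> \<open>The Harnack inequality asks for strict positivity, so a constant is added to
      \<open>heat h\<close>, scaled to make the error exactly e.\<close>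
    define \<epsilon> where "\<epsilon> = e / ?C"
    have eps: "0 < \<epsilon>" using e by (simp add: \<epsilon>_def)
    let ?u = "\<lambda>t x. heat h t x + \<epsilon>"
    have "heat_solution ?u"
      by (rule heat_solution_add_const[OF heat_solution_heat[where h = h and B = B, OF h]])
    moreover have "0 < ?u t x" if "0 \<le> t" for t x
      using heat_nonneg[where h = h and B = B, OF h that, of x] eps by simp
    moreover have "?u t x \<le> B + \<epsilon>" if "0 \<le> t" for t x
      using heat_le[where h = h and B = B, OF h that, of x] by simp
    moreover have "(real (gdist E x y))\<^sup>2 \<le> t"
      using y t by (simp add: gball_def) (metis of_nat_0_le_iff real_sqrt_ge_0_iff power_mono real_sqrt_pow2 less_imp_le)
    ultimately have "?u t x \<le> ?C * ?u (2 * t) y"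
      using harnack_parabolic[of ?u "B + \<epsilon>" x y "gdist E x y" t] connected_gdist t by blast
    also have "\<dots> = ?C * heat h (2 * t) y + e" by (simp add: \<epsilon>_def distrib_left)
    finally show "heat h t x \<le> ?C * heat h (2 * t) y + e" using eps by linarith
  qed
  have "v * heat h t x \<le> (\<Sum>y\<in>?b. \<mu> y) * heat h t x"
    using vol heat_nonneg[where h = h and B = B, OF h, of t x] t by (intro mult_right_mono) (auto simp: volume_def)
  also have "\<dots> \<le> (\<Sum>y\<in>?b. \<mu> y * (?C * heat h (2 * t) y))"
    unfolding sum_distrib_right using le measure_pos
    by (intro sum_mono mult_left_mono) (auto simp: less_imp_le)
  also have "\<dots> = ?C * (\<Sum>y\<in>?b. \<mu> y * heat h (2 * t) y)"
    by (simp add: sum_distrib_left mult_ac)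
  also have "\<dots> \<le> ?C * S"
    using heat_mass_le[where h = h and B = B and S = S, OF h, of "2 * t" ?b] S fin t by (intro mult_left_mono) auto
  finally show ?thesis using vol(2) by (simp add: field_simps)
qed

lemma heat_decay_polynomial:
  assumes m: "0 < m" and c3: "0 < c3" "\<And>x R. 0 < R \<Longrightarrow> volume E \<mu> x R \<ge> c3 * R powr m"
    and a: "0 < a" "\<And>x. a \<le> \<mu> x"
  obtains K where "0 < K"
    "\<And>h B S (t :: real) x. (\<And>x. 0 \<le> h x) \<Longrightarrow> (\<And>x. h x \<le> B) \<Longrightarrow>
      (\<And>F. finite F \<Longrightarrow> (\<Sum>x\<in>F. \<mu> x * h x) \<le> S) \<Longrightarrow> 0 \<le> t \<Longrightarrow>
      heat h t x \<le> K * S * (1 + t) powr (- (m / 2))"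
proof
  \<comment> \<open>The first entry serves t > 1, by Harnack; the second serves t \<le> 1, where the
    mass carried by one vertex already gives the bound S / a.\<close>
  define C where "C = max (2 powr n * exp (4 / c) / c3) (1 / a)"
  have C: "0 < C" using a by (simp add: C_def less_max_iff_disj)
  show "0 < C * 2 powr (m / 2)" using C by simp
  fix h :: "'v \<Rightarrow> real" and B S t :: real and x
  assume h: "\<And>x. 0 \<le> h x" "\<And>x. h x \<le> B" and t: "0 \<le> t"
    and S: "\<And>F. finite F \<Longrightarrow> (\<Sum>x\<in>F. \<mu> x * h x) \<le> S"
  have S0: "0 \<le> S" using S[of "{}"] by simp
  have "heat h t x \<le> C * S * (max 1 t) powr (- (m / 2))"
  proof (cases "t \<le> 1")
    case True
    have "a * heat h t x \<le> \<mu> x * heat h t x"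
      by (intro mult_right_mono a heat_nonneg[where h = h and B = B, OF h] t)
    also have "\<dots> \<le> S" using heat_mass_le[where h = h and B = B and S = S, OF h t S, of "{x}"] by simp
    finally have "heat h t x \<le> 1 / a * S" using a by (simp add: field_simps)
    also have "\<dots> \<le> C * S" using S0 by (intro mult_right_mono) (auto simp: C_def)
    finally show ?thesis using True by (simp add: max_absorb1)
  next
    case False
    then have t1: "0 < t" "1 < t" by auto
    have "heat h t x \<le> 2 powr n * exp (4 / c) * S / (c3 * sqrt t powr m)"
      by (rule heat_decay[where h = h and B = B and S = S, OF h S]) (use c3 t1 in auto)
    also have "sqrt t powr m = t powr (m / 2)"
      using t1 by (simp add: powr_half_sqrt[symmetric] powr_powr)
    also have "2 powr n * exp (4 / c) * S / (c3 * t powr (m / 2))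
        = 2 powr n * exp (4 / c) / c3 * S * t powr (- (m / 2))"
      by (simp add: powr_minus_divide)
    also have "\<dots> \<le> C * S * t powr (- (m / 2))"
      using S0 by (intro mult_right_mono) (auto simp: C_def)
    finally show ?thesis using False by (simp add: max_def)
  qed
  \<comment> \<open>From max 1 t \<ge> (1 + t) / 2, at the cost of the factor
    \<open>2 powr (m / 2)\<close>.\<close>
  also have "\<dots> \<le> C * S * ((1 + t) / 2) powr (- (m / 2))"
    using t m C S0 by (intro mult_left_mono powr_mono2') auto
  also have "((1 + t) / 2) powr (- (m / 2)) = 2 powr (m / 2) * (1 + t) powr (- (m / 2))"
    using t by (simp add: powr_divide powr_minus_divide)
  finally show "heat h t x \<le> C * 2 powr (m / 2) * S * (1 + t) powr (- (m / 2))"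
    by (simp add: mult_ac)
qed

end

section \<open>Globally Lipschitz equations\<close>

text \<open>Integration gains a factor 1 / k on the exponential part; this gain makes Picard
  iteration contract on an unbounded time interval.\<close>

lemma norm_integral_le_exp:
  fixes g :: "real \<Rightarrow> 'a::banach"
  assumes g: "continuous_on {0..t} g" and le: "\<And>s. 0 \<le> s \<Longrightarrow> s \<le> t \<Longrightarrow> norm (g s) \<le> a + b * exp (k * s)"
    and "0 < k" "0 \<le> t" "0 \<le> b"
  shows "norm (integral {0..t} g) \<le> a * t + b / k * exp (k * t)"
proof -
  have hi: "((\<lambda>s. a + b * exp (k * s)) has_integral
      (a * t + b / k * exp (k * t)) - (a * 0 + b / k * exp (k * 0))) {0..t}"
    using assms by (intro fundamental_theorem_of_calculus)
      (auto intro!: derivative_eq_intros simp flip: has_real_derivative_iff_has_vector_derivative)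
  have "norm (integral {0..t} g) \<le> integral {0..t} (\<lambda>s. a + b * exp (k * s))"
    using g hi le by (intro integral_norm_bound_integral integrable_continuous_interval)
      (auto intro!: continuous_intros)
  also have "\<dots> = (a * t + b / k * exp (k * t)) - (a * 0 + b / k * exp (k * 0))"
    by (rule integral_unique[OF hi])
  also have "\<dots> \<le> a * t + b / k * exp (k * t)" using assms by simp
  finally show ?thesis .
qed

text \<open>
  Picard iteration is a contraction on all of \<open>[0, \<infinity>)\<close> for the norm weighted by \<open>exp (- 2 L t)\<close>;
  times are clipped at \<open>0\<close> in order to work with functions on the whole line.
\<close>

lemma lipschitz_ode_global:
  fixes G :: "'a::banach \<Rightarrow> 'a"
  assumes L: "0 < L" and lip: "\<And>x y. norm (G x - G y) \<le> L * norm (x - y)"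
  obtains u where "u 0 = u0"
    "\<And>t. 0 \<le> t \<Longrightarrow> (u has_vector_derivative G (u t)) (at t within {0..})"
proof -
  define k where "k = 2 * L"
  have k: "0 < k" using L by (simp add: k_def)
  have contG: "continuous_on S G" for S
  proof (rule continuous_on_subset[OF _ subset_UNIV], rule continuous_onI)
    fix x e assume "0 < (e :: real)"
    have "dist (G x') (G x) \<le> e" if "dist x' x < e / L" for x'
    proof -
      have "dist (G x') (G x) \<le> L * dist x' x" using lip by (simp add: dist_norm)
      also have "\<dots> \<le> e" using that L by (simp add: field_simps)
      finally show ?thesis .
    qed
    then show "\<exists>d>0. \<forall>x'\<in>UNIV. dist x' x < d \<longrightarrow> dist (G x') (G x) \<le> e"
      using L \<open>0 < e\<close> by (intro exI[of _ "e / L"]) simp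
  qed
  \<comment> \<open>The unknown w stands for exp (- k t) u, which stays bounded even if u grows; P
    is the integral equation for u written in terms of w. Its contraction factor is L / k =
    1/2.\<close>
  define g where "g w s = G (exp (k * s) *\<^sub>R w s)" for w :: "real \<Rightarrow> 'a" and s
  define P where "P w t = exp (- k * max 0 t) *\<^sub>R (u0 + integral {0..max 0 t} (g w))"
    for w :: "real \<Rightarrow> 'a" and t
  have contg: "continuous_on S (g (apply_bcontfun w))" for S and w :: "real \<Rightarrow>\<^sub>C 'a"
    unfolding g_def by (intro continuous_on_compose2[OF contG[of UNIV]] continuous_intros) auto
  have deriv: "((\<lambda>t. integral {0..t} (g (apply_bcontfun w))) has_vector_derivative g w t) (at t within {0..})"
    if "0 \<le> t" for t and w :: "real \<Rightarrow>\<^sub>C 'a"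
  proof -
    have "at t within {0..} = at t within {0..t+1}"
      by (rule at_within_nhd[of t "{..<t+1}"]) auto
    then show ?thesis
      using integral_has_vector_derivative[OF contg, of t 0 "t + 1" w] that by simp
  qed
  have contP: "continuous_on UNIV (P (apply_bcontfun w))" for w :: "real \<Rightarrow>\<^sub>C 'a"
  proof -
    have "continuous_on {0..} (\<lambda>t. integral {0..t} (g (apply_bcontfun w)))"
      using deriv by (auto simp: continuous_on_eq_continuous_within intro: has_vector_derivative_continuous)
    then have "continuous_on UNIV (\<lambda>t. integral {0..max 0 t} (g (apply_bcontfun w)))"
      by (rule continuous_on_compose2) (auto intro!: continuous_intros)
    then show ?thesis unfolding P_def by (intro continuous_intros)
  qed
  have normg: "norm (g (apply_bcontfun w) s) \<le> norm (G 0) + L * norm w * exp (k * s)"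
    for w :: "real \<Rightarrow>\<^sub>C 'a" and s
  proof -
    have "norm (g w s) \<le> norm (G 0) + norm (g w s - G 0)" by (rule norm_triangle_sub)
    also have "norm (g w s - G 0) \<le> L * (exp (k * s) * norm (apply_bcontfun w s))"
      using lip[of "exp (k * s) *\<^sub>R w s" 0] by (simp add: g_def)
    also have "\<dots> \<le> L * (exp (k * s) * norm w)"
      using L by (intro mult_left_mono norm_bounded) auto
    finally show ?thesis by (simp add: mult_ac)
  qed
  have bddP: "norm (P (apply_bcontfun w) t) \<le> norm u0 + norm (G 0) / k + L * norm w / k"
    for w :: "real \<Rightarrow>\<^sub>C 'a" and t
  proof -
    define r where "r = max 0 t"
    have r: "0 \<le> r" by (simp add: r_def)
    have "norm (P w t) \<le> exp (- k * r) * (norm u0 + norm (integral {0..r} (g w)))"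
      unfolding P_def r_def[symmetric] by (simp add: norm_triangle_ineq)
    also have "\<dots> \<le> exp (- k * r) * (norm u0 + (norm (G 0) * r + L * norm w / k * exp (k * r)))"
      using norm_integral_le_exp[OF contg normg k r] L by simp
    also have "\<dots> = exp (- k * r) * norm u0 + norm (G 0) * (r * exp (- k * r)) + L * norm w / k"
      by (simp add: distrib_left mult_ac exp_minus)
    also have "\<dots> \<le> 1 * norm u0 + norm (G 0) * (1 / k) + L * norm w / k"
    proof -
      have "k * r \<le> exp (k * r)" using exp_ge_add_one_self[of "k * r"] by linarith
      then have "r * exp (- k * r) \<le> 1 / k" using k by (simp add: exp_minus field_simps)
      then show ?thesis using k r by (intro add_mono mult_mono) auto
    qed
    finally show ?thesis by simp
  qed
  define \<Psi> where "\<Psi> w = Bcontfun (P (apply_bcontfun w))" for w :: "real \<Rightarrow>\<^sub>C 'a"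
  have \<Psi>: "apply_bcontfun (\<Psi> w) = P (apply_bcontfun w)" for w
    unfolding \<Psi>_def by (intro Bcontfun_inverse bcontfun_normI[OF contP bddP])
  have "dist (\<Psi> w) (\<Psi> w') \<le> 1 / 2 * dist w w'" for w w'
  proof (rule dist_bound)
    fix t :: real
    define r where "r = max 0 t"
    have r: "0 \<le> r" by (simp add: r_def)
    have eq: "P w t - P w' t = exp (- k * r) *\<^sub>R integral {0..r} (\<lambda>s. g w s - g w' s)"
      unfolding P_def r_def[symmetric]
      by (subst integral_diff)
        (auto simp: scaleR_diff_right scaleR_add_right intro!: integrable_continuous_interval contg)
    have le: "norm (integral {0..r} (\<lambda>s. g w s - g w' s)) \<le> 0 * r + L * dist w w' / k * exp (k * r)"
    proof (rule norm_integral_le_exp)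
      show "continuous_on {0..r} (\<lambda>s. g w s - g w' s)" by (intro continuous_intros contg)
      fix s
      have "norm (g w s - g w' s) \<le> L * norm (exp (k * s) *\<^sub>R w s - exp (k * s) *\<^sub>R w' s)"
        unfolding g_def by (rule lip)
      also have "\<dots> = L * (exp (k * s) * dist (w s) (w' s))"
        by (simp add: dist_norm flip: scaleR_diff_right)
      also have "\<dots> \<le> L * (exp (k * s) * dist w w')"
        using L by (intro mult_left_mono dist_bounded) auto
      finally show "norm (g w s - g w' s) \<le> 0 + L * dist w w' * exp (k * s)" by (simp add: mult_ac)
    qed (use k r L in auto)
    have "dist (P w t) (P w' t) = exp (- k * r) * norm (integral {0..r} (\<lambda>s. g w s - g w' s))"
      by (simp add: dist_norm eq)
    also have "\<dots> \<le> exp (- k * r) * (0 * r + L * dist w w' / k * exp (k * r))"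
      by (intro mult_left_mono le) simp
    also have "\<dots> = L / k * dist w w'" by (simp add: exp_minus)
    also have "L / k = 1 / 2" using L by (simp add: k_def)
    finally show "dist (\<Psi> w t) (\<Psi> w' t) \<le> 1 / 2 * dist w w'" by (simp add: \<Psi>)
  qed
  then obtain w where w: "\<Psi> w = w" using banach_fix_type[of "1 / 2" \<Psi>] by auto
  define u where "u t = u0 + integral {0..t} (g w)" for t
  have u: "u t = exp (k * t) *\<^sub>R w t" if "0 \<le> t" for t
  proof -
    have "w t = P w t" using w \<Psi>[of w] by simp
    also have "\<dots> = exp (- k * t) *\<^sub>R u t" using that by (simp add: P_def u_def max_def)
    finally show ?thesis by (simp add: exp_minus)
  qed
  show ?thesis
  proof
    show "u 0 = u0" by (simp add: u_def)
    show "(u has_vector_derivative G (u t)) (at t within {0..})" if "0 \<le> t" for t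
      using has_vector_derivative_add[OF has_vector_derivative_const deriv[OF that, of w], of u0] u[OF that]
      unfolding u_def[abs_def] by (simp add: g_def)
  qed
qed

text \<open>Needed because the state space of the next equation is itself a space of bounded
  continuous functions.\<close>

instance bcontfun :: (metric_space, banach) banach ..

text \<open>With the discrete topology on the index set every bounded function is continuous, so the
  bounded functions form a Banach space type. Evaluation at an index is bounded linear, which gives
  pointwise derivatives, while norm continuity gives continuity uniform in the index.\<close>

lemma sup_norm_lipschitz_ode_global:
  fixes G :: "('i \<Rightarrow> real) \<Rightarrow> 'i \<Rightarrow> real"
  assumes L: "0 < L" and lip: "\<And>f g K i. (\<And>j. \<bar>f j - g j\<bar> \<le> K) \<Longrightarrow> \<bar>G f i - G g i\<bar> \<le> L * K"
    and G0: "\<And>i. \<bar>G (\<lambda>_. 0) i\<bar> \<le> M" and w0: "\<And>i. \<bar>w0 i\<bar> \<le> M0"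
  obtains w where "w 0 = w0" "\<And>t. 0 \<le> t \<Longrightarrow> \<exists>B. \<forall>i. \<bar>w t i\<bar> \<le> B"
    "\<And>t i. 0 \<le> t \<Longrightarrow> ((\<lambda>s. w s i) has_real_derivative G (w t) i) (at t within {0..})"
    "\<And>t e. 0 \<le> t \<Longrightarrow> 0 < e \<Longrightarrow> \<exists>d>0. \<forall>s\<ge>0. \<bar>s - t\<bar> < d \<longrightarrow> (\<forall>i. \<bar>w s i - w t i\<bar> < e)"
proof -
  define enc where "enc f = (Bcontfun (\<lambda>d. f (of_discrete d)) :: 'i discrete \<Rightarrow>\<^sub>C real)" for f
  define dec where "dec \<phi> i = apply_bcontfun \<phi> (discrete i)" for \<phi> :: "'i discrete \<Rightarrow>\<^sub>C real" and i
  have cont: "continuous_on UNIV (h :: 'i discrete \<Rightarrow> real)" for h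
    by (simp add: continuous_on_open_vimage open_discrete)
  have dec_enc: "dec (enc f) = f" if "\<And>i. \<bar>f i\<bar> \<le> B" for f B
  proof -
    have "(\<lambda>d. f (of_discrete d)) \<in> bcontfun"
      by (rule bcontfun_normI[OF cont, of _ B]) (simp add: that)
    then show ?thesis
      by (simp add: dec_def[abs_def] enc_def Bcontfun_inverse discrete_inverse)
  qed
  have dec_diff: "dec \<phi> i - dec \<psi> i = dec (\<phi> - \<psi>) i" for \<phi> \<psi> i by (simp add: dec_def)
  have dec_le: "\<bar>dec \<phi> i\<bar> \<le> norm \<phi>" for \<phi> i
    using norm_bounded[of \<phi> "discrete i"] by (simp add: dec_def)
  have norm_le: "norm \<phi> \<le> K" if "\<And>i. \<bar>dec \<phi> i\<bar> \<le> K" for \<phi> K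
  proof (rule norm_bound)
    fix d show "norm (apply_bcontfun \<phi> d) \<le> K"
      using that[of "of_discrete d"] by (simp add: dec_def of_discrete_inverse)
  qed
  define H where "H \<phi> = enc (G (dec \<phi>))" for \<phi>
  have H: "dec (H \<phi>) = G (dec \<phi>)" for \<phi>
    unfolding H_def
  proof (rule dec_enc)
    fix i show "\<bar>G (dec \<phi>) i\<bar> \<le> M + L * norm \<phi>"
      using lip[of "dec \<phi>" "\<lambda>_. 0" "norm \<phi>" i] dec_le G0[of i] by fastforce
  qed
  have "norm (H \<phi> - H \<psi>) \<le> L * norm (\<phi> - \<psi>)" for \<phi> \<psi>
  proof (rule norm_le)
    fix i
    have "\<bar>G (dec \<phi>) i - G (dec \<psi>) i\<bar> \<le> L * norm (\<phi> - \<psi>)"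
      by (rule lip) (simp add: dec_diff dec_le)
    then show "\<bar>dec (H \<phi> - H \<psi>) i\<bar> \<le> L * norm (\<phi> - \<psi>)" by (simp add: H flip: dec_diff)
  qed
  then obtain \<phi> where \<phi>: "\<phi> 0 = enc w0"
    "\<And>t. 0 \<le> t \<Longrightarrow> (\<phi> has_vector_derivative H (\<phi> t)) (at t within {0..})"
    using lipschitz_ode_global[OF L, of H "enc w0"] by blast
  have lin: "bounded_linear (\<lambda>\<phi>. dec \<phi> i)" for i
    by (rule bounded_linear_intro[of _ 1]) (use dec_le[of _ i] in \<open>auto simp: dec_def\<close>)
  show ?thesis
  proof (rule that[of "\<lambda>t. dec (\<phi> t)"])
    show "dec (\<phi> 0) = w0" using dec_enc[of w0 M0] w0 by (simp add: \<phi>)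
    show "\<exists>B. \<forall>i. \<bar>dec (\<phi> t) i\<bar> \<le> B" for t using dec_le by blast
    show "((\<lambda>s. dec (\<phi> s) i) has_real_derivative G (dec (\<phi> t)) i) (at t within {0..})" if "0 \<le> t" for t i
      using bounded_linear.has_vector_derivative[OF lin \<phi>(2)[OF that], of i]
      by (simp add: H has_real_derivative_iff_has_vector_derivative)
    show "\<exists>d>0. \<forall>s\<ge>0. \<bar>s - t\<bar> < d \<longrightarrow> (\<forall>i. \<bar>dec (\<phi> s) i - dec (\<phi> t) i\<bar> < e)"
      if t: "0 \<le> t" and e: "0 < e" for t e
    proof -
      have "continuous (at t within {0..}) \<phi>"
        by (rule has_vector_derivative_continuous[OF \<phi>(2)[OF t]])
      then obtain d where "0 < d" "\<And>s. 0 \<le> s \<Longrightarrow> dist s t < d \<Longrightarrow> dist (\<phi> s) (\<phi> t) < e"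
        using e by (auto simp: continuous_within_eps_delta)
      then show ?thesis
        by (intro exI[of _ d]) (auto simp: dist_norm dec_diff intro: order.strict_trans1[OF dec_le])
    qed
  qed
qed

section \<open>Truncated systems and comparison\<close>

text \<open>Clipping at both ends yields a nonlinearity that is monotone and globally Lipschitz on
  the whole line, including negative arguments, which are excluded only afterwards.\<close>

definition truncated_powr :: "real \<Rightarrow> real \<Rightarrow> real \<Rightarrow> real"
  where "truncated_powr M p z = (min M (max 0 z)) powr p"

lemma truncated_powr_eq: "0 \<le> z \<Longrightarrow> z \<le> M \<Longrightarrow> truncated_powr M p z = z powr p"
  by (simp add: truncated_powr_def max_absorb2 min_absorb2)

lemma truncated_powr_mono: "0 \<le> M \<Longrightarrow> 0 \<le> p \<Longrightarrow> x \<le> y \<Longrightarrow> truncated_powr M p x \<le> truncated_powr M p y"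
  by (auto simp: truncated_powr_def intro!: powr_mono2)

lemma powr_diff_le:
  fixes x y M p :: real
  assumes "0 \<le> x" "x \<le> y" "y \<le> M" "1 \<le> p"
  shows "y powr p - x powr p \<le> p * M powr (p - 1) * (y - x)"
proof (cases "x = y")
  case False
  then have "x < y" using assms by simp
  moreover have "continuous_on {x..y} (\<lambda>z. z powr p)"
    using assms by (intro continuous_on_powr' continuous_intros) auto
  moreover have deriv: "((\<lambda>z. z powr p) has_real_derivative p * z powr (p - 1)) (at z)" if "x < z" for z
    using that assms by (auto intro!: derivative_eq_intros)
  ultimately obtain l z where z: "x < z" "z < y" "DERIV (\<lambda>z. z powr p) z :> l"
      "y powr p - x powr p = (y - x) * l"
    using MVT[of x y "\<lambda>z. z powr p"] real_differentiable_def by metis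
  have "l = p * z powr (p - 1)"
    by (rule DERIV_unique[OF z(3) deriv[OF z(1)]])
  also have "\<dots> \<le> p * M powr (p - 1)"
    using z assms by (intro mult_left_mono powr_mono2) auto
  finally have "(y - x) * l \<le> (y - x) * (p * M powr (p - 1))"
    using assms by (intro mult_left_mono) auto
  then show ?thesis using z(4) by (simp add: mult.commute)
qed simp

lemma truncated_powr_diff_le:
  assumes "0 \<le> M" "1 \<le> p" "x \<le> y"
  shows "truncated_powr M p y - truncated_powr M p x \<le> p * M powr (p - 1) * (y - x)"
proof -
  have "truncated_powr M p y - truncated_powr M p x
      \<le> p * M powr (p - 1) * (min M (max 0 y) - min M (max 0 x))"
    unfolding truncated_powr_def using assms by (intro powr_diff_le) auto
  also have "\<dots> \<le> p * M powr (p - 1) * (y - x)"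
    using assms by (intro mult_left_mono) auto
  finally show ?thesis .
qed

lemma truncated_powr_lipschitz:
  assumes "0 \<le> M" "1 \<le> p"
  shows "\<bar>truncated_powr M p y - truncated_powr M p x\<bar> \<le> p * M powr (p - 1) * \<bar>y - x\<bar>"
  using truncated_powr_diff_le[OF assms, of x y] truncated_powr_diff_le[OF assms, of y x]
    truncated_powr_mono[of M p x y] truncated_powr_mono[of M p y x] assms
  by (cases "x \<le> y") auto

section \<open>Comparison for two coupled components\<close>

text \<open>The regularity that the maximum principle asks of each function. The derivative is a
  free parameter so that sub- and supersolutions, which satisfy only inequalities, are covered
  too.\<close>

definition evolves :: "real \<Rightarrow> (real \<Rightarrow> 'v \<Rightarrow> real) \<Rightarrow> (real \<Rightarrow> 'v \<Rightarrow> real) \<Rightarrow> bool"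
  where "evolves T u u' \<longleftrightarrow>
    (\<exists>B. \<forall>t x. 0 \<le> t \<longrightarrow> t \<le> T \<longrightarrow> \<bar>u t x\<bar> \<le> B) \<and>
    (\<forall>x. continuous_on {0..T} (\<lambda>t. u t x)) \<and>
    (\<forall>t x. 0 < t \<longrightarrow> t < T \<longrightarrow> ((\<lambda>s. u s x) has_real_derivative u' t x) (at t))"

lemma evolvesI:
  assumes deriv: "\<And>t x. 0 \<le> t \<Longrightarrow> t \<le> T \<Longrightarrow> ((\<lambda>s. u s x) has_real_derivative u' t x) (at t within {0..T})"
    and bdd: "\<And>t x. 0 \<le> t \<Longrightarrow> t \<le> T \<Longrightarrow> \<bar>u t x\<bar> \<le> B"
  shows "evolves T u u'"
  unfolding evolves_def
proof (intro conjI allI impI)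
  show "\<exists>B. \<forall>t x. 0 \<le> t \<longrightarrow> t \<le> T \<longrightarrow> \<bar>u t x\<bar> \<le> B" using bdd by blast
  show "continuous_on {0..T} (\<lambda>t. u t x)" for x
    using deriv by (auto intro!: DERIV_continuous_on)
  show "((\<lambda>s. u s x) has_real_derivative u' t x) (at t)" if "0 < t" "t < T" for t x
    using deriv[of t x] that by (simp add: at_within_Icc_at)
qed

lemma (in bounded_degree_graph) comparison:
  fixes F1 F2 :: "real \<Rightarrow> real"
  assumes L: "0 \<le> L"
    and F1: "mono F1" "\<And>a b. a \<le> b \<Longrightarrow> F1 b - F1 a \<le> L * (b - a)"
    and F2: "mono F2" "\<And>a b. a \<le> b \<Longrightarrow> F2 b - F2 a \<le> L * (b - a)"
    and ev: "evolves T u1 u1'" "evolves T v1 v1'" "evolves T u2 u2'" "evolves T v2 v2'"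
    and sub: "\<And>t x. 0 < t \<Longrightarrow> t < T \<Longrightarrow> u1' t x \<le> \<Delta> (u1 t) x + F1 (v1 t x)"
      "\<And>t x. 0 < t \<Longrightarrow> t < T \<Longrightarrow> v1' t x \<le> \<Delta> (v1 t) x + F2 (u1 t x)"
    and super: "\<And>t x. 0 < t \<Longrightarrow> t < T \<Longrightarrow> \<Delta> (u2 t) x + F1 (v2 t x) \<le> u2' t x"
      "\<And>t x. 0 < t \<Longrightarrow> t < T \<Longrightarrow> \<Delta> (v2 t) x + F2 (u2 t x) \<le> v2' t x"
    and init: "\<And>x. u1 0 x \<le> u2 0 x" "\<And>x. v1 0 x \<le> v2 0 x"
    and t: "0 \<le> t" "t \<le> T"
  shows "u1 t x \<le> u2 t x \<and> v1 t x \<le> v2 t x"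
proof -
  \<comment> \<open>Both components become one family over \<open>'v \<times> bool\<close>, so a
    single upper bound K controls the diffusion and the coupling at once.\<close>
  define w where "w t i = (if snd i then u1 t (fst i) - u2 t (fst i) else v1 t (fst i) - v2 t (fst i))"
    for t and i :: "'v \<times> bool"
  define w' where "w' t i = (if snd i then u1' t (fst i) - u2' t (fst i) else v1' t (fst i) - v2' t (fst i))"
    for t and i :: "'v \<times> bool"
  obtain B1 B2 B3 B4 where B: "\<And>t x. 0 \<le> t \<Longrightarrow> t \<le> T \<Longrightarrow> \<bar>u1 t x\<bar> \<le> B1"
    "\<And>t x. 0 \<le> t \<Longrightarrow> t \<le> T \<Longrightarrow> \<bar>v1 t x\<bar> \<le> B2" "\<And>t x. 0 \<le> t \<Longrightarrow> t \<le> T \<Longrightarrow> \<bar>u2 t x\<bar> \<le> B3"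
    "\<And>t x. 0 \<le> t \<Longrightarrow> t \<le> T \<Longrightarrow> \<bar>v2 t x\<bar> \<le> B4"
    using ev unfolding evolves_def by (elim conjE exE) blast
  \<comment> \<open>Cooperativity: where b \<le> a, monotonicity makes the left side nonpositive, so
    an upper bound on the other component's difference suffices.\<close>
  have F_le: "F b - F a \<le> L * K"
    if F: "mono F" "\<And>a b. a \<le> b \<Longrightarrow> F b - F a \<le> L * (b - a)" and K: "b - a \<le> K" "0 \<le> K"
    for F :: "real \<Rightarrow> real" and a b K
  proof (cases "b \<le> a")
    case True
    then have "F b \<le> F a" by (rule monoD[OF F(1)])
    then show ?thesis using L K by (smt (verit) mult_nonneg_nonneg)
  next
    case False
    then have "F b - F a \<le> L * (b - a)" by (intro F(2)) simp
    also have "\<dots> \<le> L * K" using K L by (intro mult_left_mono)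
    finally show ?thesis .
  qed
  have le: "w t i \<le> 0" for i
  proof (rule bounded_maximum_principle[where w = w and w' = w' and a = 0 and b = T and L = "D + L"
      and B = "max (B1 + B3) (B2 + B4)"])
    show "0 < D + L" using D_pos L by simp
    show "w s j \<le> max (B1 + B3) (B2 + B4)" if "0 \<le> s" "s \<le> T" for s j
      using B(1,3)[OF that, of "fst j"] B(2,4)[OF that, of "fst j"] by (auto simp: w_def)
    show "w 0 j \<le> 0" for j using init by (simp add: w_def)
    show "continuous_on {0..T} (\<lambda>s. w s j)" for j
      using ev by (cases "snd j") (auto simp: w_def evolves_def intro!: continuous_intros)
    show "((\<lambda>s. w s j) has_real_derivative w' s j) (at s)" if "0 < s" "s < T" for s j
      using ev that by (cases "snd j") (auto simp: w_def w'_def evolves_def intro!: DERIV_diff)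
    show "w' s j \<le> (D + L) * K" if s: "0 < s" "s < T" and pos: "0 < w s j" and K: "\<And>i. w s i \<le> K" for s j K
    proof -
      let ?x = "fst j"
      have Ku: "u1 s y - u2 s y \<le> K" for y using K[of "(y, True)"] by (simp add: w_def)
      have Kv: "v1 s y - v2 s y \<le> K" for y using K[of "(y, False)"] by (simp add: w_def)
      have K0: "0 \<le> K" using pos K[of j] by linarith
      show ?thesis
      proof (cases "snd j")
        case True
        have "w' s j \<le> \<Delta> (\<lambda>y. u1 s y - u2 s y) ?x + (F1 (v1 s ?x) - F1 (v2 s ?x))"
          using sub(1)[OF s, of ?x] super(1)[OF s, of ?x] True by (simp add: w'_def laplacian_diff)
        also have "\<dots> \<le> D * K + L * K"
          using Ku Kv K0 pos True by (intro add_mono laplacian_le F_le[OF F1]) (auto simp: w_def)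
        finally show ?thesis by (simp add: distrib_right)
      next
        case False
        have "w' s j \<le> \<Delta> (\<lambda>y. v1 s y - v2 s y) ?x + (F2 (u1 s ?x) - F2 (u2 s ?x))"
          using sub(2)[OF s, of ?x] super(2)[OF s, of ?x] False by (simp add: w'_def laplacian_diff)
        also have "\<dots> \<le> D * K + L * K"
          using Ku Kv K0 pos False by (intro add_mono laplacian_le F_le[OF F2]) (auto simp: w_def)
        finally show ?thesis by (simp add: distrib_right)
      qed
    qed
  qed (use t in auto)
  show ?thesis using le[of "(x, True)"] le[of "(x, False)"] by (simp add: w_def)
qed

text \<open>Continuity in the supremum norm bounds u near each time, and bisection of the interval
  merges the local bounds into one.\<close>

lemma cont_ell_infty_bounded:
  assumes "cont_ell_infty T u" "0 \<le> T"
  obtains B where "\<And>t x. 0 \<le> t \<Longrightarrow> t \<le> T \<Longrightarrow> \<bar>u t x\<bar> \<le> B"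
proof -
  let ?P = "\<lambda>a b. \<exists>B. \<forall>t x. a \<le> t \<and> t \<le> b \<and> 0 \<le> t \<and> t \<le> T \<longrightarrow> \<bar>u t x\<bar> \<le> B"
  have "?P 0 T"
  proof (rule Bolzano[of 0 T ?P])
    fix a b c
    assume "?P a b" "?P b c"
    then obtain B1 B2 where "\<forall>t x. a \<le> t \<and> t \<le> b \<and> 0 \<le> t \<and> t \<le> T \<longrightarrow> \<bar>u t x\<bar> \<le> B1"
      "\<forall>t x. b \<le> t \<and> t \<le> c \<and> 0 \<le> t \<and> t \<le> T \<longrightarrow> \<bar>u t x\<bar> \<le> B2" by blast
    then have "\<forall>t x. a \<le> t \<and> t \<le> c \<and> 0 \<le> t \<and> t \<le> T \<longrightarrow> \<bar>u t x\<bar> \<le> max B1 B2"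
      by (metis linear max.coboundedI1 max.coboundedI2)
    then show "?P a c" by blast
  next
    fix r assume r: "0 \<le> r" "r \<le> T"
    have bd: "bounded (range (u t))" if "0 \<le> t" "t \<le> T" for t
      using assms that by (auto simp: cont_ell_infty_def in_ell_infty_def)
    obtain B where B: "\<And>x. \<bar>u r x\<bar> \<le> B" using bd[OF r] by (auto simp: bounded_iff)
    have "((\<lambda>s. ell_infty_norm (\<lambda>x. u s x - u r x)) \<longlongrightarrow> 0) (at r within {0..T})"
      using assms r by (auto simp: cont_ell_infty_def)
    then have "\<forall>\<^sub>F s in at r within {0..T}. ell_infty_norm (\<lambda>x. u s x - u r x) < 1"
      by (rule order_tendstoD) simp
    then obtain d where d: "0 < d"
      "\<And>s. s \<in> {0..T} \<Longrightarrow> s \<noteq> r \<Longrightarrow> dist s r < d \<Longrightarrow> ell_infty_norm (\<lambda>x. u s x - u r x) < 1"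
      by (auto simp: eventually_at)
    have "\<bar>u s x\<bar> \<le> B + 1" if s: "0 \<le> s" "s \<le> T" "\<bar>s - r\<bar> < d" for s x
    proof (cases "s = r")
      case False
      have "bounded (range (\<lambda>x. u s x - u r x))" by (rule bounded_minus_comp[OF bd[OF s(1,2)] bd[OF r]])
      \<comment> \<open>The real supremum in \<open>ell_infty_norm\<close> dominates its entries
        only once they are known to be bounded.\<close>
      then have "bdd_above (range (\<lambda>x. \<bar>u s x - u r x\<bar>))"
        by (fastforce simp: bounded_iff intro: bdd_aboveI)
      then have "\<bar>u s x - u r x\<bar> \<le> ell_infty_norm (\<lambda>x. u s x - u r x)"
        unfolding ell_infty_norm_def by (rule cSUP_upper[OF UNIV_I])
      also have "\<dots> < 1" using d(2)[of s] s False by (simp add: dist_real_def)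
      finally show ?thesis using B[of x] by linarith
    qed (use B[of x] in simp)
    then show "\<exists>d>0. \<forall>a b. a \<le> r \<and> r \<le> b \<and> b - a < d \<longrightarrow> ?P a b"
      by (intro exI[of _ d] conjI d(1) allI impI exI[of _ "B + 1"]) (auto simp: abs_less_iff)
  qed (rule assms(2))
  then show ?thesis using that by blast
qed

lemma cont_ell_inftyI:
  assumes "\<And>t. 0 \<le> t \<Longrightarrow> \<exists>B. \<forall>x. \<bar>u t x\<bar> \<le> B"
    and "\<And>t e. 0 \<le> t \<Longrightarrow> 0 < e \<Longrightarrow> \<exists>d>0. \<forall>s\<ge>0. \<bar>s - t\<bar> < d \<longrightarrow> (\<forall>x. \<bar>u s x - u t x\<bar> < e)"
  shows "cont_ell_infty T u"
  unfolding cont_ell_infty_def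
proof (intro conjI ballI)
  fix t assume t: "t \<in> {0..T}"
  show "in_ell_infty (u t)"
    using assms(1)[of t] t by (auto simp: in_ell_infty_def bounded_iff)
  show "((\<lambda>s. ell_infty_norm (\<lambda>x. u s x - u t x)) \<longlongrightarrow> 0) (at t within {0..T})"
  proof (rule tendstoI)
    fix e :: real assume "0 < e"
    \<comment> \<open>Half of e, since a supremum of values below a bound may attain it.\<close>
    then obtain d where d: "0 < d" "\<And>s x. 0 \<le> s \<Longrightarrow> \<bar>s - t\<bar> < d \<Longrightarrow> \<bar>u s x - u t x\<bar> < e / 2"
      using assms(2)[of t "e / 2"] t by auto
    have "dist (ell_infty_norm (\<lambda>x. u s x - u t x)) 0 < e" if s: "0 \<le> s" "\<bar>s - t\<bar> < d" for s
    proof -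
      have le: "\<bar>u s x - u t x\<bar> \<le> e / 2" for x using d(2)[OF s, of x] by simp
      then have "ell_infty_norm (\<lambda>x. u s x - u t x) \<le> e / 2"
        unfolding ell_infty_norm_def by (intro cSUP_least) auto
      moreover have "0 \<le> ell_infty_norm (\<lambda>x. u s x - u t x)"
        unfolding ell_infty_norm_def using le
        by (intro cSUP_upper2[OF _ UNIV_I]) (auto intro!: bdd_aboveI[of _ "e / 2"])
      ultimately show ?thesis using \<open>0 < e\<close> by simp
    qed
    then show "\<forall>\<^sub>F s in at t within {0..T}. dist (ell_infty_norm (\<lambda>x. u s x - u t x)) 0 < e"
      using d(1) by (auto simp: eventually_at dist_real_def)
  qed
qed

context bounded_degree_graph
begin

lemma abs_laplacian_le:
  assumes "\<And>y. \<bar>f y\<bar> \<le> K"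
  shows "\<bar>\<Delta> f x\<bar> \<le> 2 * D * K"
proof -
  have f: "f y \<le> K" "- f y \<le> K" for y using assms[of y] by auto
  have "\<Delta> f x + D * f x \<le> D * K" "- \<Delta> f x + D * - f x \<le> D * K"
    using shifted_le[of f K x, OF f(1)] shifted_le[of "\<lambda>y. - f y" K x, OF f(2)]
      laplacian_cmult[of "-1" f x] by (simp_all add: shifted_def)
  moreover have "D * f x \<le> D * K" "D * - f x \<le> D * K"
    using f[of x] D_pos by (simp_all only: mult_le_cancel_left_pos)
  ultimately show ?thesis by (simp add: abs_le_iff)
qed

lemma truncated_system_global:
  assumes M: "0 \<le> M" and p: "1 \<le> p" and q: "1 \<le> q"
    and u0: "\<And>x. \<bar>u0 x\<bar> \<le> B" and v0: "\<And>x. \<bar>v0 x\<bar> \<le> B"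
  obtains U W where "U 0 = u0" "W 0 = v0" "\<And>T. cont_ell_infty T U" "\<And>T. cont_ell_infty T W"
    "\<And>t x. 0 \<le> t \<Longrightarrow> ((\<lambda>s. U s x) has_real_derivative \<Delta> (U t) x + truncated_powr M p (W t x))
      (at t within {0..})"
    "\<And>t x. 0 \<le> t \<Longrightarrow> ((\<lambda>s. W s x) has_real_derivative \<Delta> (W t) x + truncated_powr M q (U t x))
      (at t within {0..})"
proof -
  define F where "F b = truncated_powr M (if b then p else q)" for b
  define l where "l = p * M powr (p - 1) + q * M powr (q - 1)"
  have F_lip: "\<bar>F b y - F b x\<bar> \<le> l * \<bar>y - x\<bar>" for b x y
  proof -
    have "\<bar>F b y - F b x\<bar> \<le> (if b then p else q) * M powr ((if b then p else q) - 1) * \<bar>y - x\<bar>"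
      unfolding F_def using M p q by (intro truncated_powr_lipschitz) auto
    also have "\<dots> \<le> l * \<bar>y - x\<bar>"
      using p q by (intro mult_right_mono) (auto simp: l_def)
    finally show ?thesis .
  qed
  \<comment> \<open>The flag of an index selects the component, and flipping it expresses the
    coupling.\<close>
  define G where "G f i = \<Delta> (\<lambda>y. f (y, snd i)) (fst i) + F (snd i) (f (fst i, \<not> snd i))"
    for f and i :: "'v \<times> bool"
  obtain w where w: "w 0 = (\<lambda>i. if snd i then u0 (fst i) else v0 (fst i))"
    "\<And>t. 0 \<le> t \<Longrightarrow> \<exists>B. \<forall>i. \<bar>w t i\<bar> \<le> B"
    "\<And>t i. 0 \<le> t \<Longrightarrow> ((\<lambda>s. w s i) has_real_derivative G (w t) i) (at t within {0..})"
    "\<And>t e. 0 \<le> t \<Longrightarrow> 0 < e \<Longrightarrow> \<exists>d>0. \<forall>s\<ge>0. \<bar>s - t\<bar> < d \<longrightarrow> (\<forall>i. \<bar>w s i - w t i\<bar> < e)"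
  proof (rule sup_norm_lipschitz_ode_global[of "2 * D + l" G "F True 0 + F False 0"
      "\<lambda>i. if snd i then u0 (fst i) else v0 (fst i)" B])
    show "0 < 2 * D + l" using D_pos p q by (simp add: l_def add_pos_nonneg)
    show "\<bar>G f i - G g i\<bar> \<le> (2 * D + l) * K" if K: "\<And>j. \<bar>f j - g j\<bar> \<le> K" for f g K i
    proof -
      have "G f i - G g i = \<Delta> (\<lambda>y. f (y, snd i) - g (y, snd i)) (fst i)
          + (F (snd i) (f (fst i, \<not> snd i)) - F (snd i) (g (fst i, \<not> snd i)))"
        by (simp add: G_def laplacian_diff)
      moreover have "\<bar>\<Delta> (\<lambda>y. f (y, snd i) - g (y, snd i)) (fst i)\<bar> \<le> 2 * D * K"
        by (intro abs_laplacian_le K)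
      moreover have "\<bar>F (snd i) (f (fst i, \<not> snd i)) - F (snd i) (g (fst i, \<not> snd i))\<bar> \<le> l * K"
        by (rule order_trans[OF F_lip]) (use p q K in \<open>auto simp: l_def intro!: mult_left_mono\<close>)
      ultimately show ?thesis by (simp add: distrib_right)
    qed
    show "\<bar>G (\<lambda>_. 0) i\<bar> \<le> F True 0 + F False 0" for i
      by (cases "snd i") (simp_all add: G_def F_def laplacian_def truncated_powr_def)
    show "\<bar>if snd i then u0 (fst i) else v0 (fst i)\<bar> \<le> B" for i using u0 v0 by simp
  qed blast
  show ?thesis
  proof (rule that[of "\<lambda>t x. w t (x, True)" "\<lambda>t x. w t (x, False)"])
    have "cont_ell_infty T (\<lambda>t x. w t (x, b))" for T b
    proof (rule cont_ell_inftyI)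
      show "\<exists>B. \<forall>x. \<bar>w t (x, b)\<bar> \<le> B" if "0 \<le> t" for t using w(2)[OF that] by blast
      show "\<exists>d>0. \<forall>s\<ge>0. \<bar>s - t\<bar> < d \<longrightarrow> (\<forall>x. \<bar>w s (x, b) - w t (x, b)\<bar> < e)"
        if "0 \<le> t" "0 < e" for t e using w(4)[OF that] by blast
    qed
    then show "cont_ell_infty T (\<lambda>t x. w t (x, True))" "cont_ell_infty T (\<lambda>t x. w t (x, False))" for T
      by auto
    show "((\<lambda>s. w s (x, True)) has_real_derivative
        \<Delta> (\<lambda>x. w t (x, True)) x + truncated_powr M p (w t (x, False))) (at t within {0..})"
      if "0 \<le> t" for t x using w(3)[OF that, of "(x, True)"] by (simp add: G_def F_def)
    show "((\<lambda>s. w s (x, False)) has_real_derivative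
        \<Delta> (\<lambda>x. w t (x, False)) x + truncated_powr M q (w t (x, True))) (at t within {0..})"
      if "0 \<le> t" for t x using w(3)[OF that, of "(x, False)"] by (simp add: G_def F_def)
  qed (simp_all add: w(1))
qed

lemma truncated_comparison:
  assumes M: "0 \<le> M" and p: "1 \<le> p" and q: "1 \<le> q"
    and ev: "evolves T u1 u1'" "evolves T v1 v1'" "evolves T u2 u2'" "evolves T v2 v2'"
    and sub: "\<And>t x. 0 < t \<Longrightarrow> t < T \<Longrightarrow> u1' t x \<le> \<Delta> (u1 t) x + truncated_powr M p (v1 t x)"
      "\<And>t x. 0 < t \<Longrightarrow> t < T \<Longrightarrow> v1' t x \<le> \<Delta> (v1 t) x + truncated_powr M q (u1 t x)"
    and super: "\<And>t x. 0 < t \<Longrightarrow> t < T \<Longrightarrow> \<Delta> (u2 t) x + truncated_powr M p (v2 t x) \<le> u2' t x"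
      "\<And>t x. 0 < t \<Longrightarrow> t < T \<Longrightarrow> \<Delta> (v2 t) x + truncated_powr M q (u2 t x) \<le> v2' t x"
    and init: "\<And>x. u1 0 x \<le> u2 0 x" "\<And>x. v1 0 x \<le> v2 0 x"
    and t: "0 \<le> t" "t \<le> T"
  shows "u1 t x \<le> u2 t x \<and> v1 t x \<le> v2 t x"
proof (rule comparison[where L = "p * M powr (p - 1) + q * M powr (q - 1)", OF _ _ _ _ _ ev sub super init t])
  show "0 \<le> p * M powr (p - 1) + q * M powr (q - 1)" using p q by simp
  show "mono (truncated_powr M p)" "mono (truncated_powr M q)"
    using M p q by (auto intro!: monoI truncated_powr_mono)
  show "truncated_powr M p b - truncated_powr M p a \<le> (p * M powr (p - 1) + q * M powr (q - 1)) * (b - a)"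
    if "a \<le> b" for a b
    by (rule order_trans[OF truncated_powr_diff_le[OF M p that]])
      (use p q that in \<open>auto intro!: mult_right_mono\<close>)
  show "truncated_powr M q b - truncated_powr M q a \<le> (p * M powr (p - 1) + q * M powr (q - 1)) * (b - a)"
    if "a \<le> b" for a b
    by (rule order_trans[OF truncated_powr_diff_le[OF M q that]])
      (use p q that in \<open>auto intro!: mult_right_mono\<close>)
qed

section \<open>Uniqueness and continuation of solutions\<close>

lemma solution_evolves:
  assumes "is_solution E \<omega> \<mu> p q u0 v0 T u v" "0 \<le> T"
  shows "evolves T u (\<lambda>t x. \<Delta> (u t) x + v t x powr p)"
    and "evolves T v (\<lambda>t x. \<Delta> (v t) x + u t x powr q)"
proof -
  have "cont_ell_infty T u" "cont_ell_infty T v" using assms by (auto simp: is_solution_def)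
  then obtain B1 B2 where "\<And>t x. 0 \<le> t \<Longrightarrow> t \<le> T \<Longrightarrow> \<bar>u t x\<bar> \<le> B1"
    "\<And>t x. 0 \<le> t \<Longrightarrow> t \<le> T \<Longrightarrow> \<bar>v t x\<bar> \<le> B2"
    using assms(2) cont_ell_infty_bounded by metis
  then show "evolves T u (\<lambda>t x. \<Delta> (u t) x + v t x powr p)"
    and "evolves T v (\<lambda>t x. \<Delta> (v t) x + u t x powr q)"
    using assms(1) by (auto simp: is_solution_def intro!: evolvesI)
qed

text \<open>Both solutions are bounded on [0, T], hence solve the system truncated at a common bound
  and can be compared. Used in both orders, this is uniqueness.\<close>

lemma solution_le_solution:
  assumes p: "1 \<le> p" and q: "1 \<le> q" and T: "0 < T"
    and s1: "is_solution E \<omega> \<mu> p q u0 v0 T u1 v1" and s2: "is_solution E \<omega> \<mu> p q u0 v0 T u2 v2"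
    and t: "0 \<le> t" "t \<le> T"
  shows "u1 t x \<le> u2 t x \<and> v1 t x \<le> v2 t x"
proof -
  note ev = solution_evolves[OF s1 less_imp_le[OF T]] solution_evolves[OF s2 less_imp_le[OF T]]
  obtain B1 B2 B3 B4 where "\<And>t x. 0 \<le> t \<Longrightarrow> t \<le> T \<Longrightarrow> \<bar>u1 t x\<bar> \<le> B1"
    "\<And>t x. 0 \<le> t \<Longrightarrow> t \<le> T \<Longrightarrow> \<bar>v1 t x\<bar> \<le> B2" "\<And>t x. 0 \<le> t \<Longrightarrow> t \<le> T \<Longrightarrow> \<bar>u2 t x\<bar> \<le> B3"
    "\<And>t x. 0 \<le> t \<Longrightarrow> t \<le> T \<Longrightarrow> \<bar>v2 t x\<bar> \<le> B4"
    using ev unfolding evolves_def by (elim conjE exE) blast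
  then have bd: "\<bar>u1 t x\<bar> \<le> \<bar>B1\<bar> + \<bar>B2\<bar> + \<bar>B3\<bar> + \<bar>B4\<bar>" "\<bar>v1 t x\<bar> \<le> \<bar>B1\<bar> + \<bar>B2\<bar> + \<bar>B3\<bar> + \<bar>B4\<bar>"
    "\<bar>u2 t x\<bar> \<le> \<bar>B1\<bar> + \<bar>B2\<bar> + \<bar>B3\<bar> + \<bar>B4\<bar>" "\<bar>v2 t x\<bar> \<le> \<bar>B1\<bar> + \<bar>B2\<bar> + \<bar>B3\<bar> + \<bar>B4\<bar>"
    if "0 \<le> t" "t \<le> T" for t x
    using that by (smt (verit))+
  define M where "M = \<bar>B1\<bar> + \<bar>B2\<bar> + \<bar>B3\<bar> + \<bar>B4\<bar>"
  have nn: "0 \<le> u1 t x" "0 \<le> v1 t x" "0 \<le> u2 t x" "0 \<le> v2 t x" if "0 \<le> t" "t \<le> T" for t x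
    using s1 s2 that by (auto simp: is_solution_def)
  have tr: "truncated_powr M r (u1 t x) = u1 t x powr r" "truncated_powr M r (v1 t x) = v1 t x powr r"
    "truncated_powr M r (u2 t x) = u2 t x powr r" "truncated_powr M r (v2 t x) = v2 t x powr r"
    if "0 \<le> t" "t \<le> T" for t x r
    using bd[OF that, of x] nn[OF that, of x] by (auto intro!: truncated_powr_eq simp: M_def)
  show ?thesis
    by (rule truncated_comparison[OF _ p q ev, of M]) (use s1 s2 t tr in \<open>auto simp: is_solution_def M_def\<close>)
qed

text \<open>The supersolution may change with T, but its bound M may not: M fixes the truncation
  level, so one pair (U, W) serves all times.\<close>

lemma global_solution_if_supersolution:
  assumes p: "1 \<le> p" and q: "1 \<le> q" and M: "0 \<le> M"
    and u0: "\<And>x. 0 \<le> u0 x" "\<And>x. u0 x \<le> B" and v0: "\<And>x. 0 \<le> v0 x" "\<And>x. v0 x \<le> B"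
    and super: "\<And>T. 0 < T \<Longrightarrow> \<exists>a a' b b'. evolves T a a' \<and> evolves T b b' \<and>
      (\<forall>t x. 0 \<le> t \<longrightarrow> t \<le> T \<longrightarrow> 0 \<le> a t x \<and> a t x \<le> M \<and> 0 \<le> b t x \<and> b t x \<le> M) \<and>
      (\<forall>t x. 0 < t \<longrightarrow> t < T \<longrightarrow>
        \<Delta> (a t) x + b t x powr p \<le> a' t x \<and> \<Delta> (b t) x + a t x powr q \<le> b' t x) \<and>
      (\<forall>x. u0 x \<le> a 0 x \<and> v0 x \<le> b 0 x)"
    and T: "0 < T" and sol: "is_solution E \<omega> \<mu> p q u0 v0 T u v"
  shows "is_global_solution E \<omega> \<mu> p q u0 v0 T u v"
proof -
  obtain U W where init: "U 0 = u0" "W 0 = v0" and cont: "\<And>T. cont_ell_infty T U" "\<And>T. cont_ell_infty T W"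
    and dU: "\<And>t x. 0 \<le> t \<Longrightarrow> ((\<lambda>s. U s x) has_real_derivative \<Delta> (U t) x + truncated_powr M p (W t x))
      (at t within {0..})"
    and dW: "\<And>t x. 0 \<le> t \<Longrightarrow> ((\<lambda>s. W s x) has_real_derivative \<Delta> (W t) x + truncated_powr M q (U t x))
      (at t within {0..})"
    using truncated_system_global[OF M p q, of u0 B v0] u0 v0 by (metis abs_of_nonneg)
  have U_sol: "is_solution E \<omega> \<mu> p q u0 v0 T U W" if T: "0 < T" for T
  proof -
    obtain B1 B2 where B: "\<And>t x. 0 \<le> t \<Longrightarrow> t \<le> T \<Longrightarrow> \<bar>U t x\<bar> \<le> B1"
      "\<And>t x. 0 \<le> t \<Longrightarrow> t \<le> T \<Longrightarrow> \<bar>W t x\<bar> \<le> B2"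
      using cont_ell_infty_bounded[OF cont(1) less_imp_le[OF T]]
        cont_ell_infty_bounded[OF cont(2) less_imp_le[OF T]] by metis
    have evU: "evolves T U (\<lambda>t x. \<Delta> (U t) x + truncated_powr M p (W t x))"
      by (rule evolvesI[OF DERIV_subset[OF dU] B(1)]) auto
    have evW: "evolves T W (\<lambda>t x. \<Delta> (W t) x + truncated_powr M q (U t x))"
      by (rule evolvesI[OF DERIV_subset[OF dW] B(2)]) auto
    have ev0: "evolves T (\<lambda>_ _. 0) (\<lambda>_ _. 0)" by (auto simp: evolves_def)
    \<comment> \<open>The zero pair serves as the subsolution.\<close>
    have nn: "0 \<le> U t x \<and> 0 \<le> W t x" if "0 \<le> t" "t \<le> T" for t x
      by (rule truncated_comparison[OF M p q ev0 ev0 evU evW])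
        (use that M p q u0 v0 init in \<open>auto simp: laplacian_def truncated_powr_def\<close>)
    obtain a a' b b' where ev: "evolves T a a'" "evolves T b b'"
      and le: "\<And>t x. 0 \<le> t \<Longrightarrow> t \<le> T \<Longrightarrow> 0 \<le> a t x \<and> a t x \<le> M \<and> 0 \<le> b t x \<and> b t x \<le> M"
      and d: "\<And>t x. 0 < t \<Longrightarrow> t < T \<Longrightarrow>
        \<Delta> (a t) x + b t x powr p \<le> a' t x \<and> \<Delta> (b t) x + a t x powr q \<le> b' t x"
      and i: "\<And>x. u0 x \<le> a 0 x \<and> v0 x \<le> b 0 x"
      using super[OF T] by blast
    \<comment> \<open>On [0, M] truncation has no effect, so the given pair is a supersolution of
      the truncated system too; lying below it, U and W solve the original system.\<close>
    have "U t x \<le> a t x \<and> W t x \<le> b t x" if "0 \<le> t" "t \<le> T" for t x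
      by (rule truncated_comparison[OF M p q evU evW ev])
        (use that le d i init in \<open>auto simp: truncated_powr_eq\<close>)
    then have UW: "U t x \<le> M" "W t x \<le> M" if "0 \<le> t" "t \<le> T" for t x
      using le[of t x] that by (meson order_trans)+
    have "((\<lambda>s. U s x) has_real_derivative \<Delta> (U t) x + W t x powr p) (at t within {0..T})"
      "((\<lambda>s. W s x) has_real_derivative \<Delta> (W t) x + U t x powr q) (at t within {0..T})"
      if t: "0 \<le> t" "t \<le> T" for t x
      using DERIV_subset[OF dU[OF t(1), of x], of "{0..T}"] DERIV_subset[OF dW[OF t(1), of x], of "{0..T}"]
        nn[OF t, of x] UW[OF t, of x] by (auto simp: truncated_powr_eq)
    then show ?thesis using nn cont init by (auto simp: is_solution_def)
  qed
  have "U t x = u t x \<and> W t x = v t x" if "t \<in> {0..T}" for t x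
    using solution_le_solution[OF p q T U_sol[OF T] sol, of t x]
      solution_le_solution[OF p q T sol U_sol[OF T], of t x] that by force
  then show ?thesis unfolding is_global_solution_def using U_sol by blast
qed

end

section \<open>Supersolutions\<close>

context bounded_degree_graph
begin

text \<open>A concave power lies below its tangent at \<open>g x\<close>, and nonnegative weights
  preserve this under summation. The tangent inequality is Young's inequality multiplied by a
  power.\<close>

lemma laplacian_powr_le:
  assumes g: "\<And>y. 0 < g y" and \<theta>: "0 < \<theta>" "\<theta> \<le> 1"
  shows "\<Delta> (\<lambda>y. g y powr \<theta>) x \<le> \<theta> * g x powr (\<theta> - 1) * \<Delta> g x"
proof -
  have tangent: "b powr \<theta> - a powr \<theta> \<le> \<theta> * a powr (\<theta> - 1) * (b - a)" if "0 < a" "0 < b" for a b :: real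
  proof -
    have "b powr \<theta> * a powr (1 - \<theta>) \<le> \<theta> * b + (1 - \<theta>) * a"
      using \<theta> that by (intro Youngs_inequality_0) auto
    then have "a powr (\<theta> - 1) * (b powr \<theta> * a powr (1 - \<theta>)) \<le> a powr (\<theta> - 1) * (\<theta> * b + (1 - \<theta>) * a)"
      by (intro mult_left_mono) auto
    moreover have "a powr (\<theta> - 1) * a powr (1 - \<theta>) = 1"
      using that by (simp flip: powr_add)
    moreover have "a powr (\<theta> - 1) * a = a powr \<theta>"
      using that powr_add[of a "\<theta> - 1" 1] by simp
    ultimately show ?thesis by (simp add: algebra_simps)
  qed
  have "(\<Sum>y\<in>nbrs x. \<omega> x y * (g y powr \<theta> - g x powr \<theta>))
      \<le> (\<Sum>y\<in>nbrs x. \<omega> x y * (\<theta> * g x powr (\<theta> - 1) * (g y - g x)))"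
    by (intro sum_mono mult_left_mono tangent g weight_nonneg)
  then have "1 / \<mu> x * (\<Sum>y\<in>nbrs x. \<omega> x y * (g y powr \<theta> - g x powr \<theta>))
      \<le> 1 / \<mu> x * (\<Sum>y\<in>nbrs x. \<omega> x y * (\<theta> * g x powr (\<theta> - 1) * (g y - g x)))"
    using measure_pos[of x] by (intro mult_left_mono) auto
  also have "\<dots> = \<theta> * g x powr (\<theta> - 1) * \<Delta> g x"
    by (simp add: laplacian_def sum_distrib_left mult_ac)
  finally show ?thesis by (simp add: laplacian_def)
qed

context
  fixes g :: "real \<Rightarrow> 'v \<Rightarrow> real" and T \<kappa> \<eta> :: real
  assumes g: "heat_solution g"
    and g_pos: "\<And>t x. 0 \<le> t \<Longrightarrow> t \<le> T \<Longrightarrow> 0 < g t x"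
    and g_le: "\<And>t x. 0 \<le> t \<Longrightarrow> t \<le> T \<Longrightarrow> g t x \<le> \<eta> * (1 + t) powr (- \<kappa>)"
    and \<kappa>: "0 < \<kappa>" and \<eta>: "0 < \<eta>" "\<eta> \<le> 1"
begin

text \<open>
  By concavity the powers \<open>g\<^sup>e\<close> with \<open>e \<le> 1\<close> are supersolutions of the heat equation, and the growing
  coefficient of \<open>g\<^sup>\<theta>\<close> produces the nonlinear source. Taking \<open>\<theta>\<close> above \<open>\<alpha> / \<kappa>\<close> keeps this
  second term below the first one, thanks to the decay of \<open>g\<close>; taking \<open>\<theta>\<close> at most \<open>(\<alpha> + 1) / \<kappa>\<close>
  lets \<open>g\<^sup>\<theta>\<close> dominate the \<open>p\<close>-th power of the other barrier.
\<close>

definition barrier :: "real \<Rightarrow> real \<Rightarrow> real \<Rightarrow> real \<Rightarrow> 'v \<Rightarrow> real"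
  where "barrier \<alpha> \<theta> A t x = g t x powr (\<alpha> / \<kappa>) + A * (1 + t) powr (\<kappa> * \<theta> - \<alpha>) * g t x powr \<theta>"

definition barrier' :: "real \<Rightarrow> real \<Rightarrow> real \<Rightarrow> real \<Rightarrow> 'v \<Rightarrow> real"
  where "barrier' \<alpha> \<theta> A t x = \<alpha> / \<kappa> * g t x powr (\<alpha> / \<kappa> - 1) * \<Delta> (g t) x
    + A * (1 + t) powr (\<kappa> * \<theta> - \<alpha>) * (\<theta> * g t x powr (\<theta> - 1) * \<Delta> (g t) x)
    + A * (\<kappa> * \<theta> - \<alpha>) * (1 + t) powr (\<kappa> * \<theta> - \<alpha> - 1) * g t x powr \<theta>"

lemma g_powr_le:
  assumes t: "0 \<le> t" "t \<le> T" and e: "0 \<le> e"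
  shows "g t x powr e \<le> \<eta> powr e * (1 + t) powr (- (\<kappa> * e))"
proof -
  have "g t x powr e \<le> (\<eta> * (1 + t) powr (- \<kappa>)) powr e"
    using g_pos[OF t, of x] g_le[OF t, of x] e by (intro powr_mono2) auto
  also have "\<dots> = \<eta> powr e * (1 + t) powr (- (\<kappa> * e))"
    using \<eta> t by (simp add: powr_mult powr_powr)
  finally show ?thesis .
qed

text \<open>In the ratio of the second term to the first, the decay of g cancels the growth of the
  coefficient exactly and leaves A \<eta>^(\<theta> - \<alpha>/\<kappa>).\<close>

lemma barrier_le:
  assumes t: "0 \<le> t" "t \<le> T" and \<theta>: "\<alpha> / \<kappa> < \<theta>" and A: "0 \<le> A" "A * \<eta> powr (\<theta> - \<alpha> / \<kappa>) \<le> 1"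
  shows "barrier \<alpha> \<theta> A t x \<le> 2 * g t x powr (\<alpha> / \<kappa>)"
proof -
  let ?e = "\<theta> - \<alpha> / \<kappa>"
  have ke: "\<kappa> * ?e = \<kappa> * \<theta> - \<alpha>" using \<kappa> by (simp add: field_simps)
  have "A * (1 + t) powr (\<kappa> * \<theta> - \<alpha>) * g t x powr ?e
      \<le> A * (1 + t) powr (\<kappa> * \<theta> - \<alpha>) * (\<eta> powr ?e * (1 + t) powr (- (\<kappa> * ?e)))"
    using g_powr_le[OF t, of ?e x] \<theta> A by (intro mult_left_mono) auto
  also have "\<dots> = A * \<eta> powr ?e * ((1 + t) powr (\<kappa> * \<theta> - \<alpha>) * (1 + t) powr (- (\<kappa> * \<theta> - \<alpha>)))"
    unfolding ke by simp
  also have "\<dots> = A * \<eta> powr ?e" using t by (simp flip: powr_add)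
  also have "\<dots> \<le> 1" by (rule A(2))
  finally have "A * (1 + t) powr (\<kappa> * \<theta> - \<alpha>) * g t x powr ?e * g t x powr (\<alpha> / \<kappa>) \<le> 1 * g t x powr (\<alpha> / \<kappa>)"
    by (intro mult_right_mono) auto
  moreover have "g t x powr ?e * g t x powr (\<alpha> / \<kappa>) = g t x powr \<theta>"
    using g_pos[OF t, of x] by (simp flip: powr_add)
  ultimately show ?thesis by (simp add: barrier_def mult.assoc)
qed

lemma barrier_nonneg: "0 \<le> A \<Longrightarrow> 0 \<le> barrier \<alpha> \<theta> A t x"
  by (simp add: barrier_def)

lemma barrier_le_2:
  assumes t: "0 \<le> t" "t \<le> T" and \<alpha>: "0 < \<alpha>" and \<theta>: "\<alpha> / \<kappa> < \<theta>"
    and A: "0 \<le> A" "A * \<eta> powr (\<theta> - \<alpha> / \<kappa>) \<le> 1"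
  shows "barrier \<alpha> \<theta> A t x \<le> 2"
proof -
  have "g t x \<le> 1 * 1"
    using g_le[OF t, of x] \<eta> \<kappa> t
    by (elim order_trans, intro mult_mono) (auto simp: powr_minus_divide ge_one_powr_ge_zero)
  then have "g t x powr (\<alpha> / \<kappa>) \<le> 1 powr (\<alpha> / \<kappa>)"
    using g_pos[OF t, of x] \<alpha> \<kappa> by (intro powr_mono2) auto
  then show ?thesis using barrier_le[OF t \<theta> A, of x] by simp
qed

lemma barrier_deriv:
  assumes t: "0 \<le> t" "t \<le> T"
  shows "((\<lambda>s. barrier \<alpha> \<theta> A s x) has_real_derivative barrier' \<alpha> \<theta> A t x) (at t)"
proof -
  have g': "((\<lambda>s. g s x) has_real_derivative \<Delta> (g t) x) (at t)"
    using g by (simp add: heat_solution_def)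
  have pw: "((\<lambda>s. g s x powr e) has_real_derivative e * g t x powr (e - 1) * \<Delta> (g t) x) (at t)" for e
    using g_pos[OF t, of x] by (auto intro!: derivative_eq_intros g')
  have tp: "((\<lambda>s. (1 + s) powr e) has_real_derivative e * (1 + t) powr (e - 1)) (at t)" for e
    using t by (auto intro!: derivative_eq_intros)
  show ?thesis
    unfolding barrier_def barrier'_def
    by (rule DERIV_cong[OF DERIV_add[OF pw DERIV_mult[OF DERIV_cmult[OF tp] pw]]])
      (simp add: algebra_simps)
qed

text \<open>By the normalisation of A, differentiating the coefficient yields 2^p (1 + t)^(\<kappa>
  \<theta> - \<alpha> - 1) g^\<theta>, while b^p is at most 2^p g^((\<alpha> + 1)/\<kappa>) because
  p \<beta> = \<alpha> + 1. The exponent in excess of \<theta> is traded for decay in time.\<close>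

lemma barrier_supersolution:
  assumes t: "0 \<le> t" "t \<le> T" and \<alpha>: "0 < \<alpha>" and \<theta>: "\<alpha> / \<kappa> < \<theta>" "\<theta> \<le> 1" "\<theta> \<le> (\<alpha> + 1) / \<kappa>"
    and A: "A * (\<kappa> * \<theta> - \<alpha>) = 2 powr p" "0 \<le> A"
    and \<beta>: "p * \<beta> = \<alpha> + 1" "0 \<le> p" and b: "0 \<le> b" "b \<le> 2 * g t x powr (\<beta> / \<kappa>)"
  shows "\<Delta> (barrier \<alpha> \<theta> A t) x + b powr p \<le> barrier' \<alpha> \<theta> A t x"
proof -
  note gp = g_pos[OF t]
  have "0 < \<alpha> / \<kappa>" using \<alpha> \<kappa> by simp
  then have \<theta>0: "0 < \<alpha> / \<kappa>" "\<alpha> / \<kappa> \<le> 1" "0 < \<theta>" using \<theta> by auto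
  have "\<Delta> (barrier \<alpha> \<theta> A t) x = \<Delta> (\<lambda>y. g t y powr (\<alpha> / \<kappa>)) x
      + A * (1 + t) powr (\<kappa> * \<theta> - \<alpha>) * \<Delta> (\<lambda>y. g t y powr \<theta>) x"
    by (simp add: barrier_def[abs_def] laplacian_add laplacian_cmult)
  also have "\<dots> \<le> \<alpha> / \<kappa> * g t x powr (\<alpha> / \<kappa> - 1) * \<Delta> (g t) x
      + A * (1 + t) powr (\<kappa> * \<theta> - \<alpha>) * (\<theta> * g t x powr (\<theta> - 1) * \<Delta> (g t) x)"
    using A(2) by (intro add_mono mult_left_mono laplacian_powr_le gp \<theta>0 \<theta>) auto
  finally have 1: "\<Delta> (barrier \<alpha> \<theta> A t) x \<le> \<dots>" .
  have "b powr p \<le> (2 * g t x powr (\<beta> / \<kappa>)) powr p"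
    using b \<beta> by (intro powr_mono2)
  also have "\<dots> = 2 powr p * g t x powr ((\<alpha> + 1) / \<kappa>)"
    using \<beta>(1) by (simp add: powr_mult powr_powr mult.commute)
  also have "g t x powr ((\<alpha> + 1) / \<kappa>) = g t x powr ((\<alpha> + 1) / \<kappa> - \<theta>) * g t x powr \<theta>"
    using gp[of x] by (simp flip: powr_add)
  also have "\<dots> \<le> (1 + t) powr (\<kappa> * \<theta> - \<alpha> - 1) * g t x powr \<theta>"
  proof (rule mult_right_mono)
    let ?e = "(\<alpha> + 1) / \<kappa> - \<theta>"
    have ke: "- (\<kappa> * ?e) = \<kappa> * \<theta> - \<alpha> - 1" using \<kappa> by (simp add: field_simps)
    have "g t x powr ?e \<le> \<eta> powr ?e * (1 + t) powr (- (\<kappa> * ?e))"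
      using \<theta> by (intro g_powr_le t) simp
    also have "\<dots> \<le> 1 powr ?e * (1 + t) powr (- (\<kappa> * ?e))"
      using \<eta> \<theta> by (intro mult_right_mono powr_mono2) auto
    finally show "g t x powr ?e \<le> (1 + t) powr (\<kappa> * \<theta> - \<alpha> - 1)" unfolding ke by simp
  qed simp
  finally have 2: "b powr p \<le> A * (\<kappa> * \<theta> - \<alpha>) * (1 + t) powr (\<kappa> * \<theta> - \<alpha> - 1) * g t x powr \<theta>"
    by (simp add: A(1) mult.assoc)
  show ?thesis using 1 2 unfolding barrier'_def by linarith
qed

text \<open>Each barrier sees the other only through the bound of \<open>barrier_le\<close>, so the
  coupling causes no circularity in the choice of A and A'.\<close>

lemma barrier_pair:
  assumes T: "0 \<le> T" and p: "0 \<le> p" and q: "0 \<le> q" and \<alpha>: "0 < \<alpha>" and \<beta>: "0 < \<beta>"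
    and pq: "p * \<beta> = \<alpha> + 1" "q * \<alpha> = \<beta> + 1"
    and \<theta>: "\<alpha> / \<kappa> < \<theta>" "\<theta> \<le> 1" "\<theta> \<le> (\<alpha> + 1) / \<kappa>"
    and \<theta>': "\<beta> / \<kappa> < \<theta>'" "\<theta>' \<le> 1" "\<theta>' \<le> (\<beta> + 1) / \<kappa>"
    and A: "A * (\<kappa> * \<theta> - \<alpha>) = 2 powr p" "0 \<le> A" "A * \<eta> powr (\<theta> - \<alpha> / \<kappa>) \<le> 1"
    and A': "A' * (\<kappa> * \<theta>' - \<beta>) = 2 powr q" "0 \<le> A'" "A' * \<eta> powr (\<theta>' - \<beta> / \<kappa>) \<le> 1"
    and init: "\<And>x. u0 x \<le> g 0 x powr (\<alpha> / \<kappa>)" "\<And>x. v0 x \<le> g 0 x powr (\<beta> / \<kappa>)"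
  shows "\<exists>a a' b b'. evolves T a a' \<and> evolves T b b' \<and>
      (\<forall>t x. 0 \<le> t \<longrightarrow> t \<le> T \<longrightarrow> 0 \<le> a t x \<and> a t x \<le> 2 \<and> 0 \<le> b t x \<and> b t x \<le> 2) \<and>
      (\<forall>t x. 0 < t \<longrightarrow> t < T \<longrightarrow>
        \<Delta> (a t) x + b t x powr p \<le> a' t x \<and> \<Delta> (b t) x + a t x powr q \<le> b' t x) \<and>
      (\<forall>x. u0 x \<le> a 0 x \<and> v0 x \<le> b 0 x)"
proof (intro exI conjI allI impI)
  let ?a = "barrier \<alpha> \<theta> A" and ?b = "barrier \<beta> \<theta>' A'"
  show nn: "0 \<le> ?a t x" "0 \<le> ?b t x" for t x by (rule barrier_nonneg, fact)+
  show le: "?a t x \<le> 2" "?b t x \<le> 2" if "0 \<le> t" "t \<le> T" for t x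
    using barrier_le_2[OF that \<alpha> \<theta>(1) A(2,3)] barrier_le_2[OF that \<beta> \<theta>'(1) A'(2,3)] by auto
  show "evolves T ?a (barrier' \<alpha> \<theta> A)" "evolves T ?b (barrier' \<beta> \<theta>' A')"
    by (rule evolvesI[where B = 2], rule has_field_derivative_at_within, erule (1) barrier_deriv,
        use le nn in simp)+
  show "\<Delta> (?a t) x + ?b t x powr p \<le> barrier' \<alpha> \<theta> A t x" if "0 < t" "t < T" for t x
    using that by (intro barrier_supersolution[OF _ _ \<alpha> \<theta> A(1,2) pq(1) p] barrier_nonneg A'
        barrier_le \<theta>') auto
  show "\<Delta> (?b t) x + ?a t x powr q \<le> barrier' \<beta> \<theta>' A' t x" if "0 < t" "t < T" for t x
    using that by (intro barrier_supersolution[OF _ _ \<beta> \<theta>' A'(1,2) pq(2) q] barrier_nonneg A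
        barrier_le \<theta>) auto
  show "u0 x \<le> ?a 0 x" "v0 x \<le> ?b 0 x" for x
    using init[of x] A(2) A'(2) by (auto simp: barrier_def intro: add_increasing2)
qed

end

end

section \<open>Small data\<close>

lemma powr_mult_le_1:
  fixes A e :: real
  assumes "0 < A" "0 < e" "0 \<le> \<eta>" "\<eta> \<le> (1 / A) powr (1 / e)"
  shows "A * \<eta> powr e \<le> 1"
proof -
  have "\<eta> powr e \<le> ((1 / A) powr (1 / e)) powr e" using assms by (intro powr_mono2) auto
  also have "\<dots> = 1 / A" using assms by (simp add: powr_powr)
  finally show ?thesis using assms by (simp add: field_simps)
qed

text \<open>For x \<le> 1 a larger exponent gives a smaller power, so x^(\<kappa>/\<alpha>) \<le>
  x^r \<le> g. This lets one exponent r serve both components.\<close>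

lemma powr_exponent_swap:
  fixes x :: real
  assumes "0 \<le> x" "x \<le> 1" "0 < \<alpha>" "0 < \<kappa>" "r \<le> \<kappa> / \<alpha>" "x powr r \<le> g"
  shows "x \<le> g powr (\<alpha> / \<kappa>)"
proof -
  have "x = (x powr (\<kappa> / \<alpha>)) powr (\<alpha> / \<kappa>)" using assms by (simp add: powr_powr)
  also have "\<dots> \<le> g powr (\<alpha> / \<kappa>)"
    using assms powr_mono'[of r "\<kappa> / \<alpha>" x] by (intro powr_mono2) auto
  finally show ?thesis .
qed

lemma (in weighted_graph) mass_powr:
  assumes "in_ell \<mu> r f" "\<And>x. 0 \<le> f x" "finite F"
  shows "(\<Sum>x\<in>F. \<mu> x * f x powr r) \<le> (\<Sum>\<^sub>\<infinity>x. \<mu> x * \<bar>f x\<bar> powr r)"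
proof -
  have "(\<Sum>x\<in>F. \<mu> x * \<bar>f x\<bar> powr r) \<le> (\<Sum>\<^sub>\<infinity>x. \<mu> x * \<bar>f x\<bar> powr r)"
    using assms measure_pos by (intro finite_sum_le_infsum) (auto simp: in_ell_def less_imp_le)
  then show ?thesis using assms(2) by simp
qed

lemma (in nonneg_curved_graph) global_existence_small_data:
  fixes m c3 a p q r :: real
  assumes m: "0 < m" and c3: "0 < c3" "\<And>x R. 0 < R \<Longrightarrow> volume E \<mu> x R \<ge> c3 * R powr m"
    and a: "0 < a" "\<And>x. a \<le> \<mu> x"
    and p: "1 \<le> p" and q: "1 \<le> q" and pq: "1 < p * q"
    and crit: "(max p q + 1) / (p * q - 1) < m / 2"
    and r: "r = m / 2 * ((p * q - 1) / (max p q + 1))"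
  obtains \<delta> where "0 < \<delta>"
    "\<And>u0 v0 T u v. (\<And>x. 0 \<le> u0 x) \<Longrightarrow> (\<And>x. 0 \<le> v0 x) \<Longrightarrow>
      in_ell \<mu> r u0 \<Longrightarrow> in_ell \<mu> r v0 \<Longrightarrow>
      (\<Sum>\<^sub>\<infinity>x. \<mu> x * \<bar>u0 x\<bar> powr r) \<le> \<delta> \<Longrightarrow> (\<Sum>\<^sub>\<infinity>x. \<mu> x * \<bar>v0 x\<bar> powr r) \<le> \<delta> \<Longrightarrow> 0 < T \<Longrightarrow>
      is_solution E \<omega> \<mu> p q u0 v0 T u v \<Longrightarrow> is_global_solution E \<omega> \<mu> p q u0 v0 T u v"
proof -
  define \<kappa> where "\<kappa> = m / 2"
  define \<alpha> where "\<alpha> = (p + 1) / (p * q - 1)"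
  define \<beta> where "\<beta> = (q + 1) / (p * q - 1)"
  have \<kappa>: "0 < \<kappa>" using m by (simp add: \<kappa>_def)
  have \<alpha>: "0 < \<alpha>" and \<beta>: "0 < \<beta>" using p q pq by (auto simp: \<alpha>_def \<beta>_def)
  have "\<alpha> \<le> (max p q + 1) / (p * q - 1)" "\<beta> \<le> (max p q + 1) / (p * q - 1)"
    using pq unfolding \<alpha>_def \<beta>_def by (auto intro!: divide_right_mono)
  then have lt: "\<alpha> < \<kappa>" "\<beta> < \<kappa>" using crit unfolding \<kappa>_def by linarith+
  have \<beta>p: "p * \<beta> = \<alpha> + 1" and \<alpha>q: "q * \<alpha> = \<beta> + 1"
    using pq by (auto simp: \<alpha>_def \<beta>_def field_simps)
  have r_pos: "0 < r" using m pq p unfolding r by (intro mult_pos_pos divide_pos_pos) auto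
  have r_le: "r \<le> \<kappa> / \<alpha>" "r \<le> \<kappa> / \<beta>"
    unfolding r \<kappa>_def \<alpha>_def \<beta>_def using m pq p q
    by (auto simp: mult.assoc intro!: mult_left_mono divide_left_mono)
  \<comment> \<open>The largest exponents allowed by concavity and by the absorption of the source;
    \<alpha>, \<beta> < \<kappa> keeps them strictly above \<alpha>/\<kappa> and
    \<beta>/\<kappa>.\<close>
  define \<theta> where "\<theta> = min 1 ((\<alpha> + 1) / \<kappa>)"
  define \<theta>' where "\<theta>' = min 1 ((\<beta> + 1) / \<kappa>)"
  have \<theta>: "\<alpha> / \<kappa> < \<theta>" "\<theta> \<le> 1" "\<theta> \<le> (\<alpha> + 1) / \<kappa>"
    and \<theta>': "\<beta> / \<kappa> < \<theta>'" "\<theta>' \<le> 1" "\<theta>' \<le> (\<beta> + 1) / \<kappa>"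
    using lt \<kappa> by (auto simp: \<theta>_def \<theta>'_def divide_strict_right_mono)
  define A where "A = 2 powr p / (\<kappa> * \<theta> - \<alpha>)"
  define A' where "A' = 2 powr q / (\<kappa> * \<theta>' - \<beta>)"
  have "0 < \<kappa> * \<theta> - \<alpha>" "0 < \<kappa> * \<theta>' - \<beta>" using \<theta>(1) \<theta>'(1) \<kappa> by (auto simp: field_simps)
  then have A: "A * (\<kappa> * \<theta> - \<alpha>) = 2 powr p" "0 < A" and A': "A' * (\<kappa> * \<theta>' - \<beta>) = 2 powr q" "0 < A'"
    by (auto simp: A_def A'_def)
  define \<eta> where "\<eta> = min 1 (min ((1 / A) powr (1 / (\<theta> - \<alpha> / \<kappa>))) ((1 / A') powr (1 / (\<theta>' - \<beta> / \<kappa>))))"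
  have \<eta>: "0 < \<eta>" "\<eta> \<le> 1" using A A' by (auto simp: \<eta>_def)
  have A\<eta>: "A * \<eta> powr (\<theta> - \<alpha> / \<kappa>) \<le> 1" "A' * \<eta> powr (\<theta>' - \<beta> / \<kappa>) \<le> 1"
    using A A' \<eta> \<theta> \<theta>' by (auto intro!: powr_mult_le_1 simp: \<eta>_def)
  obtain K where K: "0 < K" "\<And>h B S (t :: real) x. (\<And>x. 0 \<le> h x) \<Longrightarrow> (\<And>x. h x \<le> B) \<Longrightarrow>
      (\<And>F. finite F \<Longrightarrow> (\<Sum>x\<in>F. \<mu> x * h x) \<le> S) \<Longrightarrow> 0 \<le> t \<Longrightarrow>
      heat h t x \<le> K * S * (1 + t) powr (- (m / 2))"
    using heat_decay_polynomial[OF m c3 a] by blast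
  \<comment> \<open>The entry a forces the data below 1 pointwise, as each vertex has measure at
    least a. The factor 4 accounts for the mass 2 \<delta> of h and for the half of \<eta> reserved
    for the later shift.\<close>
  define \<delta> where "\<delta> = min a (\<eta> / (4 * K))"
  show ?thesis
  proof (rule that[of \<delta>])
    show "0 < \<delta>" using a \<eta> K by (simp add: \<delta>_def)
    fix u0 v0 :: "'v \<Rightarrow> real" and T u v
    assume nn: "\<And>x. 0 \<le> u0 x" "\<And>x. 0 \<le> v0 x" and ell: "in_ell \<mu> r u0" "in_ell \<mu> r v0"
      and small: "(\<Sum>\<^sub>\<infinity>x. \<mu> x * \<bar>u0 x\<bar> powr r) \<le> \<delta>" "(\<Sum>\<^sub>\<infinity>x. \<mu> x * \<bar>v0 x\<bar> powr r) \<le> \<delta>"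
      and T: "0 < T" and sol: "is_solution E \<omega> \<mu> p q u0 v0 T u v"
    have mass: "(\<Sum>x\<in>F. \<mu> x * u0 x powr r) \<le> \<delta>" "(\<Sum>x\<in>F. \<mu> x * v0 x powr r) \<le> \<delta>" if "finite F" for F
      using mass_powr[OF ell(1) nn(1) that] mass_powr[OF ell(2) nn(2) that] small by linarith+
    have le_1: "f x \<le> 1" if f: "\<And>x. 0 \<le> f x" "\<And>F. finite F \<Longrightarrow> (\<Sum>x\<in>F. \<mu> x * f x powr r) \<le> \<delta>"
      for f and x :: 'v
    proof (rule ccontr)
      assume "\<not> f x \<le> 1"
      then have "1 < f x powr r" using r_pos by (simp add: gr_one_powr)
      then have "\<mu> x * 1 < \<mu> x * f x powr r" using measure_pos[of x] by (intro mult_strict_left_mono)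
      then show False using f(2)[of "{x}"] a(2)[of x] by (simp add: \<delta>_def)
    qed
    note u0_1 = le_1[OF nn(1) mass(1)] and v0_1 = le_1[OF nn(2) mass(2)]
    define h where "h x = u0 x powr r + v0 x powr r" for x
    have h0: "0 \<le> h x" for x by (simp add: h_def)
    have h2: "h x \<le> 2" for x
      using powr_mono2[of r "u0 x" 1] powr_mono2[of r "v0 x" 1] u0_1[of x] v0_1[of x] nn[of x] r_pos
      by (simp add: h_def)
    have hS: "(\<Sum>x\<in>F. \<mu> x * h x) \<le> 2 * \<delta>" if "finite F" for F
      using mass[OF that] by (simp add: h_def distrib_left sum.distrib)
    have K\<delta>: "K * (2 * \<delta>) \<le> \<eta> / 2" using K(1) by (simp add: \<delta>_def min_def field_simps)
    show "is_global_solution E \<omega> \<mu> p q u0 v0 T u v"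
    proof (rule global_solution_if_supersolution[OF p q _ nn(1) u0_1 nn(2) v0_1 _ T sol, of 2])
      fix T :: real assume T: "0 < T"
      \<comment> \<open>\<open>heat h\<close> may vanish, where its powers with exponent below 1 are not differentiable. The shift
        may depend on \<open>T\<close>, because the bound 2 on the barriers does not.\<close>
      define \<epsilon> where "\<epsilon> = \<eta> / 2 * (1 + T) powr (- \<kappa>)"
      have \<epsilon>: "0 < \<epsilon>" using \<eta> T by (simp add: \<epsilon>_def)
      define g where "g t x = heat h t x + \<epsilon>" for t x
      have "heat_solution g"
        using heat_solution_heat[of h 2, OF h0 h2] by (simp add: g_def[abs_def] heat_solution_add_const)
      moreover have g_pos: "0 < g t x" if "0 \<le> t" for t x
        using heat_nonneg[of h 2, OF h0 h2 that, of x] \<epsilon> by (simp add: g_def)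
      moreover have "g t x \<le> \<eta> * (1 + t) powr (- \<kappa>)" if t: "0 \<le> t" "t \<le> T" for t x
      proof -
        have "heat h t x \<le> K * (2 * \<delta>) * (1 + t) powr (- (m / 2))"
          by (rule K(2)[of h 2, OF h0 h2 hS t(1)])
        also have "\<dots> \<le> \<eta> / 2 * (1 + t) powr (- (m / 2))" by (intro mult_right_mono K\<delta>) simp
        finally have "heat h t x \<le> \<eta> / 2 * (1 + t) powr (- \<kappa>)" by (simp add: \<kappa>_def)
        moreover have "\<epsilon> \<le> \<eta> / 2 * (1 + t) powr (- \<kappa>)"
          unfolding \<epsilon>_def using t \<kappa> \<eta> by (intro mult_left_mono powr_mono2') auto
        ultimately show ?thesis by (simp add: g_def)
      qed
      moreover have "u0 x \<le> g 0 x powr (\<alpha> / \<kappa>)" "v0 x \<le> g 0 x powr (\<beta> / \<kappa>)" for x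
      proof -
        have g0: "g 0 x = u0 x powr r + v0 x powr r + \<epsilon>"
          using heat_0[of h 2, OF h0 h2] by (simp add: g_def h_def)
        have "u0 x powr r \<le> g 0 x" "v0 x powr r \<le> g 0 x"
          using \<epsilon> powr_ge_zero[of "u0 x" r] powr_ge_zero[of "v0 x" r] unfolding g0 by linarith+
        then show "u0 x \<le> g 0 x powr (\<alpha> / \<kappa>)" "v0 x \<le> g 0 x powr (\<beta> / \<kappa>)"
          using powr_exponent_swap[OF nn(1) u0_1 \<alpha> \<kappa> r_le(1)]
            powr_exponent_swap[OF nn(2) v0_1 \<beta> \<kappa> r_le(2)] by blast+
      qed
      ultimately show "\<exists>a a' b b'. evolves T a a' \<and> evolves T b b' \<and>
          (\<forall>t x. 0 \<le> t \<longrightarrow> t \<le> T \<longrightarrow> 0 \<le> a t x \<and> a t x \<le> 2 \<and> 0 \<le> b t x \<and> b t x \<le> 2) \<and>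
          (\<forall>t x. 0 < t \<longrightarrow> t < T \<longrightarrow>
            \<Delta> (a t) x + b t x powr p \<le> a' t x \<and> \<Delta> (b t) x + a t x powr q \<le> b' t x) \<and>
          (\<forall>x. u0 x \<le> a 0 x \<and> v0 x \<le> b 0 x)"
        using T p q A A'
        by (intro barrier_pair[where g = g and \<kappa> = \<kappa> and \<eta> = \<eta> and \<alpha> = \<alpha> and \<beta> = \<beta>
              and A = A and A' = A' and \<theta> = \<theta> and \<theta>' = \<theta>', OF _ _ _ \<kappa> \<eta> _ _ _ \<alpha> \<beta> \<beta>p \<alpha>q \<theta> \<theta>'])
          (auto intro: A\<eta>)
    qed simp
  qed
qed

theorem theorem2p5:
  fixes E :: "('v \<times> 'v) set"
    and \<omega> :: "'v \<Rightarrow> 'v \<Rightarrow> real"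
    and \<mu> :: "'v \<Rightarrow> real"
    and m n c3 p q r2 :: real
  assumes "0 < m"
    and "weighted_graph E \<omega> \<mu>"
    and "mu_min \<mu> > 0" and "mu_max \<mu> < \<infinity>"
    and "omega_min E \<omega> > 0" and "D_mu E \<omega> \<mu> < \<infinity>"
    and "0 < n" and "CDE E \<omega> \<mu> n 0"
    and "0 < c3" and "\<And>x R. 0 < R \<Longrightarrow> volume E \<mu> x R \<ge> c3 * R powr m"
    and "1 \<le> p" and "1 \<le> q" and "1 < p * q"
    and "(max p q + 1) / (p * q - 1) < m / 2"
    and "r2 = m / 2 * ((p * q - 1) / (max p q + 1))"
  shows "\<exists>C>0. \<forall>u0 v0.
    in_ell_infty u0 \<longrightarrow> in_ell_infty v0 \<longrightarrow>
    (\<forall>x. 0 \<le> u0 x) \<longrightarrow> (\<forall>x. 0 \<le> v0 x) \<longrightarrow>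
    in_ell \<mu> r2 u0 \<longrightarrow> in_ell \<mu> r2 v0 \<longrightarrow>
    ell_norm \<mu> r2 u0 + ell_norm \<mu> r2 v0 powr p \<le> C \<longrightarrow>
    (\<forall>T>0. \<forall>u v. is_solution E \<omega> \<mu> p q u0 v0 T u v \<longrightarrow>
      is_global_solution E \<omega> \<mu> p q u0 v0 T u v)"
proof -
  interpret weighted_graph E \<omega> \<mu> by fact
  obtain a where a: "0 < a" "\<And>x. a \<le> \<mu> x"
  proof -
    obtain a where a: "0 < ereal a" "ereal a < mu_min \<mu>" using ereal_dense2[OF assms(3)] by blast
    have "a \<le> \<mu> x" for x
      using less_INF_D[OF a(2)[unfolded mu_min_def], of x] by simp
    then show ?thesis using that[of a] a(1) by simp
  qed
  obtain b where b: "\<And>x. \<mu> x \<le> b"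
  proof -
    obtain b where b: "mu_max \<mu> < ereal b" using ereal_dense2[OF assms(4)] by blast
    have "\<mu> x \<le> b" for x
      using SUP_lessD[OF b[unfolded mu_max_def], of x] by simp
    then show ?thesis using that[of b] by simp
  qed
  obtain w where w: "0 < w" "\<And>x y. (x, y) \<in> E \<Longrightarrow> w \<le> \<omega> x y"
  proof -
    obtain w where w: "0 < ereal w" "ereal w < omega_min E \<omega>" using ereal_dense2[OF assms(5)] by blast
    have "w \<le> \<omega> x y" if "(x, y) \<in> E" for x y
      using less_INF_D[OF w(2)[unfolded omega_min_def] that] by simp
    then show ?thesis using that[of w] w(1) by simp
  qed
  obtain d where d: "\<And>x. 1 / \<mu> x * (\<Sum>y | (x, y) \<in> E. \<omega> x y) \<le> d"
  proof -
    obtain d where d: "D_mu E \<omega> \<mu> < ereal d" using ereal_dense2[OF assms(6)] by blast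
    have "1 / \<mu> x * (\<Sum>y | (x, y) \<in> E. \<omega> x y) \<le> d" for x
      using SUP_lessD[OF d[unfolded D_mu_def], of x] by simp
    then show ?thesis using that[of d] by simp
  qed
  have b0: "0 < b" using a b less_le_trans order_trans by blast
  \<comment> \<open>The maximum secures a positive degree constant; w / b bounds the jump rates from
    below, w bounding the weights and b the measure.\<close>
  interpret nonneg_curved_graph E \<omega> \<mu> "max 1 d" n "w / b"
  proof
    show "0 < max 1 d" by simp
    show "(\<Sum>y | (x, y) \<in> E. \<omega> x y) \<le> max 1 d * \<mu> x" for x
    proof -
      have "(\<Sum>y | (x, y) \<in> E. \<omega> x y) \<le> d * \<mu> x"
        using d[of x] measure_pos[of x] by (simp add: divide_le_eq)
      also have "\<dots> \<le> max 1 d * \<mu> x" using measure_pos[of x] by (intro mult_right_mono) auto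
      finally show ?thesis .
    qed
    show "0 < w / b" using w b0 by simp
    show "w / b * \<mu> x \<le> \<omega> x y" if "(x, y) \<in> E" for x y
    proof -
      have "w / b * \<mu> x \<le> w / b * b" using b w b0 by (intro mult_left_mono) auto
      then show ?thesis using w(2)[OF that] b0 by simp
    qed
  qed (use assms in auto)
  obtain \<delta> where \<delta>: "0 < \<delta>"
    "\<And>u0 v0 T u v. (\<And>x. 0 \<le> u0 x) \<Longrightarrow> (\<And>x. 0 \<le> v0 x) \<Longrightarrow>
      in_ell \<mu> r2 u0 \<Longrightarrow> in_ell \<mu> r2 v0 \<Longrightarrow>
      (\<Sum>\<^sub>\<infinity>x. \<mu> x * \<bar>u0 x\<bar> powr r2) \<le> \<delta> \<Longrightarrow> (\<Sum>\<^sub>\<infinity>x. \<mu> x * \<bar>v0 x\<bar> powr r2) \<le> \<delta> \<Longrightarrow> 0 < T \<Longrightarrow>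
      is_solution E \<omega> \<mu> p q u0 v0 T u v \<Longrightarrow> is_global_solution E \<omega> \<mu> p q u0 v0 T u v"
    using global_existence_small_data[OF assms(1,9,10) a assms(11-15)] by blast
  have r2: "0 < r2" using assms(1,11,13) unfolding assms(15) by (intro mult_pos_pos divide_pos_pos) auto
  \<comment> \<open>Both summands of the smallness condition are nonnegative, so each is at most C;
    the second entry carries the power p that is put on the norm of v0.\<close>
  define C where "C = min (\<delta> powr (1 / r2)) ((\<delta> powr (1 / r2)) powr p)"
  have "0 < C" using \<delta>(1) by (simp add: C_def)
  moreover have "(\<Sum>\<^sub>\<infinity>x. \<mu> x * \<bar>u0 x\<bar> powr r2) \<le> \<delta> \<and> (\<Sum>\<^sub>\<infinity>x. \<mu> x * \<bar>v0 x\<bar> powr r2) \<le> \<delta>"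
    if le: "ell_norm \<mu> r2 u0 + ell_norm \<mu> r2 v0 powr p \<le> C" for u0 v0
  proof (rule ccontr)
    assume "\<not> ?thesis"
    then consider "\<delta> < (\<Sum>\<^sub>\<infinity>x. \<mu> x * \<bar>u0 x\<bar> powr r2)" | "\<delta> < (\<Sum>\<^sub>\<infinity>x. \<mu> x * \<bar>v0 x\<bar> powr r2)" by linarith
    then show False
    proof cases
      case 1
      then have "\<delta> powr (1 / r2) < ell_norm \<mu> r2 u0"
        unfolding ell_norm_def using \<delta>(1) r2 by (intro powr_less_mono2) auto
      moreover have "0 \<le> ell_norm \<mu> r2 v0 powr p" by simp
      ultimately show False using le unfolding C_def by linarith
    next
      case 2
      then have "\<delta> powr (1 / r2) < ell_norm \<mu> r2 v0"
        unfolding ell_norm_def using \<delta>(1) r2 by (intro powr_less_mono2) auto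
      then have "(\<delta> powr (1 / r2)) powr p < ell_norm \<mu> r2 v0 powr p"
        using assms(11) by (intro powr_less_mono2) auto
      moreover have "0 \<le> ell_norm \<mu> r2 u0" by (simp add: ell_norm_def)
      ultimately show False using le unfolding C_def by linarith
    qed
  qed
  ultimately show ?thesis using \<delta>(2) by (intro exI[of _ C]) blast
qed

end
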